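(* For $p\in[1,\infty]$, an adaptive one-sided $(\epsilon,\ell_p)$-tester for real symmetric $d\times d$ matrices must make at least $\Omega\!\left(\frac{1}{\epsilon}d^{1-1/p}\right)$ vector-matrix-vector queries.
   Context: For a real symmetric $d\times d$ matrix $A$, $\|A\|_p$ denotes the Schatten-$p$ norm (the $\ell_p$ norm of the vector of singular values; $\|A\|_\infty$ is the operator norm), and $\lambda_{\min}(A)$ is its smallest eigenvalue. PSD means positive semidefinite. The parameter $\epsilon$ satisfies $0<\epsilon<1$, and $1/p=0$ when $p=\infty$. In the vector-matrix-vector model an algorithm accesses an unknown real symmetric $d\times d$ matrix $A$ through queries in which it chooses a pair of vectors $(v,w)$ in $\mathbb{R}^d$ and receives $v^TAw$; it is adaptive if queries may depend on the answers to previous queries. For $p\in[1,\infty]$, an $(\epsilon,\ell_p)$-tester is a (randomized) algorithm that makes such queries to $A$, outputs True with probability at least $2/3$ if $A$ is PSD, and outputs False with probability at least $2/3$ if $A$ is $\epsilon\|A\|_p$-far in spectral distance from the PSD cone, or equivalently if $\lambda_{\min}(A)\le-\epsilon\|A\|_p$. The tester is one-sided (has one-sided error) if it is guaranteed to output True on all PSD inputs, even if the input is generated by an adversary with access to the random coins of the tester. $\Omega(\cdot)$ is the standard asymptotic notation.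
   Formalization: The Ω bound is stated in the regime κ·d^{-1/p} ≤ ε ≤ 1−κ, with a constant depending only on κ>0, since one constant for all ε and d is impossible (d=1, ε→0: one query suffices); the zero matrix, which is PSD, is not counted as far from the PSD cone. *)

theory Defs
  imports "HOL-Probability.Probability" "Jordan_Normal_Form.Spectral_Radius"
begin

unbundle no inner_syntax and no vec_syntax

definition sym_mats :: "nat \<Rightarrow> real mat set" where
  "sym_mats d = {A \<in> carrier_mat d d. transpose_mat A = A}"

definition psd_mats :: "nat \<Rightarrow> real mat set" where
  "psd_mats d = {A \<in> sym_mats d. \<forall>v\<in>carrier_vec d. 0 \<le> v \<bullet> (A *\<^sub>v v)}"

definition lambda_min :: "real mat \<Rightarrow> real" where
  "lambda_min A = Min (spectrum A)"

definition singular_values :: "real mat \<Rightarrow> real multiset" where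
  "singular_values A = image_mset sqrt (proots (char_poly (transpose_mat A * A)))"

definition schatten_norm :: "ereal \<Rightarrow> real mat \<Rightarrow> real" where
  "schatten_norm p A =
     (if p = \<infinity> then Max (set_mset (singular_values A))
      else (\<Sum>s\<in>#singular_values A. s powr real_of_ereal p) powr (1 / real_of_ereal p))"

text \<open>
  The space of coin tosses is an arbitrary probability space.  Query number \<open>i\<close>
  (counting from \<open>0\<close>) is a function of the coins and of the tuple of the first \<open>i\<close> answers;
  the final output is a function of the coins and of all answers.
\<close>

record 'r vmv_algorithm =
  coins :: "'r measure"
  query :: "nat \<Rightarrow> 'r \<Rightarrow> (nat \<Rightarrow> real) \<Rightarrow> real vec \<times> real vec"
  accept :: "'r \<Rightarrow> (nat \<Rightarrow> real) \<Rightarrow> bool"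

text \<open>Tuples of \<open>i\<close> answers, as functions on \<open>{..<i}\<close> that are \<open>undefined\<close> elsewhere.\<close>

abbreviation answer_space :: "nat \<Rightarrow> (nat \<Rightarrow> real) measure" where
  "answer_space i \<equiv> PiM {..<i} (\<lambda>_. borel)"

primrec answers :: "'r vmv_algorithm \<Rightarrow> real mat \<Rightarrow> 'r \<Rightarrow> nat \<Rightarrow> nat \<Rightarrow> real" where
  "answers T A r 0 = (\<lambda>_. undefined)"
| "answers T A r (Suc i) =
     (case query T i r (answers T A r i) of
        (v, w) \<Rightarrow> (answers T A r i)(i := v \<bullet> (A *\<^sub>v w)))"

text \<open>
  Algorithms for \<open>d \<times> d\<close> matrices whose worst-case number of queries is at most \<open>q\<close>.  A run
  that wants to stop early asks for the vectors zero until \<open>q\<close> queries have been made.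

  Queries and output depend measurably on coins and answers jointly.  This is not only needed to
  make sense of a random run: with non-measurable strategies one could well-order the inputs and,
  assuming the continuum hypothesis, test with a constant number of queries.
\<close>

definition vmv_algorithm_for :: "nat \<Rightarrow> nat \<Rightarrow> 'r vmv_algorithm \<Rightarrow> bool" where
  "vmv_algorithm_for d q T \<longleftrightarrow>
     prob_space (coins T) \<and>
     (\<forall>i<q. \<forall>r\<in>space (coins T). \<forall>a\<in>space (answer_space i).
        query T i r a \<in> carrier_vec d \<times> carrier_vec d) \<and>
     (\<forall>i<q. \<forall>j<d.
        (\<lambda>(r, a). fst (query T i r a) $ j)
          \<in> borel_measurable (coins T \<Otimes>\<^sub>M answer_space i) \<and>
        (\<lambda>(r, a). snd (query T i r a) $ j)
          \<in> borel_measurable (coins T \<Otimes>\<^sub>M answer_space i)) \<and>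
     Measurable.pred (coins T \<Otimes>\<^sub>M answer_space q) (\<lambda>(r, a). accept T r a)"

definition verdict :: "nat \<Rightarrow> 'r vmv_algorithm \<Rightarrow> real mat \<Rightarrow> 'r \<Rightarrow> bool" where
  "verdict q T A r = accept T r (answers T A r q)"

text \<open>
  The inequality between the smallest eigenvalue and the Schatten norm holds with equality for
  the zero matrix, which is positive semidefinite.  Requiring rejection there would contradict
  the first clause, so only matrices outside the cone count as far from it.
\<close>

definition psd_tester :: "nat \<Rightarrow> real \<Rightarrow> ereal \<Rightarrow> nat \<Rightarrow> 'r vmv_algorithm \<Rightarrow> bool" where
  "psd_tester d \<epsilon> p q T \<longleftrightarrow>
     vmv_algorithm_for d q T \<and>
     (\<forall>A\<in>psd_mats d.
        measure (coins T) {r \<in> space (coins T). verdict q T A r} \<ge> 2 / 3) \<and>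
     (\<forall>A\<in>sym_mats d - psd_mats d. lambda_min A \<le> - \<epsilon> * schatten_norm p A \<longrightarrow>
        measure (coins T) {r \<in> space (coins T). \<not> verdict q T A r} \<ge> 2 / 3)"

text \<open>
  The input may be chosen with knowledge of the coins, so the output is \<open>True\<close> for every outcome
  of the coins and not just almost surely.
\<close>

definition one_sided :: "nat \<Rightarrow> nat \<Rightarrow> 'r vmv_algorithm \<Rightarrow> bool" where
  "one_sided d q T \<longleftrightarrow> (\<forall>r\<in>space (coins T). \<forall>A\<in>psd_mats d. verdict q T A r)"

end

theory Submission
  imports Defs
begin

text \<open>
  Take \<open>A = I - \<mu> g g\<^sup>T\<close> with \<open>g\<close> a standard Gaussian vector.  If \<open>\<mu> \<bar>g\<bar>\<^sup>2 \<le> 1\<close> then \<open>A\<close> is positive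
  semidefinite, so for every outcome of the coins a one-sided tester rejects only vectors with
  \<open>\<bar>g\<bar>\<^sup>2 > 1 / \<mu>\<close>.  The answers depend on \<open>g\<close> only through the numbers \<open>v \<bullet> g\<close> and \<open>w \<bullet> g\<close>, that is,
  through \<open>2q\<close> adaptive linear measurements.  Since the component of \<open>g\<close> orthogonal to the measured
  directions could be replaced by \<open>0\<close> without changing the verdict, a rejection even requires the
  measured component to have squared length at least \<open>1 / \<mu>\<close>.  By rotational invariance each
  measurement contributes \<open>1\<close> to the expected squared length, however adaptive the measurements are,
  so the probability of rejection is at most \<open>2q\<mu>\<close>.  On the other hand, with \<open>\<mu>\<close> a multiple of
  \<open>\<epsilon> d\<^bsup>1/p\<^esup> / d\<close>, the matrix \<open>A\<close> is far from the cone with constant probability.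
\<close>

subsection \<open>Rotational invariance of the standard Gaussian measure\<close>

definition std_gauss :: "real measure" where
  "std_gauss = density lborel (\<lambda>x. ennreal (std_normal_density x))"

lemma sets_std_gauss [simp, measurable_cong]: "sets std_gauss = sets borel"
  by (simp add: std_gauss_def)

lemma space_std_gauss [simp]: "space std_gauss = UNIV"
  by (simp add: std_gauss_def)

lemma prob_space_std_gauss: "prob_space std_gauss"
  unfolding std_gauss_def using prob_space_normal_density[of 1 0] by simp

lemma nn_integral_std_gauss:
  "f \<in> borel_measurable borel \<Longrightarrow>
   (\<integral>\<^sup>+x. f x \<partial>std_gauss) = (\<integral>\<^sup>+x. ennreal (std_normal_density x) * f x \<partial>lborel)"
  unfolding std_gauss_def by (subst nn_integral_density) auto

lemma nn_integral_std_gauss_uminus: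
  assumes [measurable]: "f \<in> borel_measurable borel"
  shows "(\<integral>\<^sup>+x. f (- x) \<partial>std_gauss) = (\<integral>\<^sup>+x. f x \<partial>std_gauss)"
proof -
  have "(\<integral>\<^sup>+x. ennreal (std_normal_density x) * f x \<partial>lborel)
      = (\<integral>\<^sup>+x. ennreal (std_normal_density (- x)) * f (- x) \<partial>lborel)"
    using nn_integral_real_affine[of "\<lambda>x. ennreal (std_normal_density x) * f x" "-1" 0] by simp
  then show ?thesis by (simp add: nn_integral_std_gauss std_normal_density_def)
qed

lemma nn_integral_shear_snd:
  assumes [measurable]: "H \<in> borel_measurable (borel \<Otimes>\<^sub>M borel)"
  shows "(\<integral>\<^sup>+x. \<integral>\<^sup>+y. H (x, y + a * x) \<partial>lborel \<partial>lborel) = (\<integral>\<^sup>+x. \<integral>\<^sup>+y. H (x, y :: real) \<partial>lborel \<partial>(lborel :: real measure))"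
proof (rule nn_integral_cong)
  fix x :: real
  show "(\<integral>\<^sup>+y. H (x, y + a * x) \<partial>lborel) = (\<integral>\<^sup>+y. H (x, y) \<partial>lborel)"
    using nn_integral_real_affine[of "\<lambda>y. H (x, y)" 1 "a * x"] by (simp add: add.commute)
qed

lemma nn_integral_shear_fst:
  assumes [measurable]: "H \<in> borel_measurable (borel \<Otimes>\<^sub>M borel)"
  shows "(\<integral>\<^sup>+x. \<integral>\<^sup>+y. H (x + a * y, y) \<partial>lborel \<partial>lborel) = (\<integral>\<^sup>+x. \<integral>\<^sup>+y. H (x, y :: real) \<partial>lborel \<partial>(lborel :: real measure))"
proof -
  have "(\<integral>\<^sup>+x. \<integral>\<^sup>+y. H (x + a * y, y) \<partial>lborel \<partial>lborel) = (\<integral>\<^sup>+y. \<integral>\<^sup>+x. H (x + a * y, y) \<partial>lborel \<partial>lborel)"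
    using lborel_pair.Fubini'[of "\<lambda>x y. H (x + a * y, y)"] by simp
  also have "\<dots> = (\<integral>\<^sup>+y. \<integral>\<^sup>+x. H (x, y) \<partial>lborel \<partial>lborel)"
    using nn_integral_shear_snd[of "\<lambda>(x, y). H (y, x)" a] by simp
  also have "\<dots> = (\<integral>\<^sup>+x. \<integral>\<^sup>+y. H (x, y) \<partial>lborel \<partial>lborel)"
    using lborel_pair.Fubini'[of "\<lambda>x y. H (x, y)"] by simp
  finally show ?thesis .
qed

text \<open>A rotation by an angle other than \<open>\<pi>\<close> is a product of three shears.\<close>

lemma nn_integral_lborel_rotate:
  assumes [measurable]: "H \<in> borel_measurable (borel \<Otimes>\<^sub>M borel)"
    and sc: "s\<^sup>2 + c\<^sup>2 = 1" and s: "s \<noteq> - 1"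
  shows "(\<integral>\<^sup>+x. \<integral>\<^sup>+y. H (s * x - c * y, c * x + s * y) \<partial>lborel \<partial>lborel)
    = (\<integral>\<^sup>+x. \<integral>\<^sup>+y. H (x, y :: real) \<partial>lborel \<partial>(lborel :: real measure))"
proof -
  \<comment> \<open>With \<open>s\<close> and \<open>c\<close> the cosine and sine of the angle,
    \<open>t\<close> is the tangent of half the angle. The rotation shears \<open>x\<close> by
    \<open>- t\<close>, then \<open>y\<close> by \<open>c\<close>, then \<open>x\<close> by
    \<open>- t\<close> again.\<close>
  define t where "t = c / (1 + s)"
  have s1: "1 + s \<noteq> 0" using s by linarith
  have ct: "1 - c * t = s" using sc s1 by (simp add: t_def field_simps power2_eq_square)
  have t1: "t * (1 + s) = c" using s1 by (simp add: t_def)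
  define H1 where "H1 = (\<lambda>(x, y). H (x + (- t) * y, y))"
  define H2 where "H2 = (\<lambda>(x, y). H1 (x, y + c * x))"
  have [measurable]: "H1 \<in> borel_measurable (borel \<Otimes>\<^sub>M borel)"
    unfolding H1_def by measurable
  have [measurable]: "H2 \<in> borel_measurable (borel \<Otimes>\<^sub>M borel)"
    unfolding H2_def by measurable
  have eq: "H2 (x + (- t) * y, y) = H (s * x - c * y, c * x + s * y)" for x y
  proof -
    have "y + c * (x - t * y) = c * x + (1 - c * t) * y"
      by (simp add: algebra_simps)
    then have y: "y + c * (x - t * y) = c * x + s * y" by (simp only: ct)
    have "x - t * y - t * (c * x + s * y) = (1 - c * t) * x - (t * (1 + s)) * y"
      by (simp add: algebra_simps)
    then have x: "x - t * y - t * (c * x + s * y) = s * x - c * y"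
      by (simp only: ct t1)
    show ?thesis by (simp add: H1_def H2_def y[simplified] x[simplified])
  qed
  have "(\<integral>\<^sup>+x. \<integral>\<^sup>+y. H (s * x - c * y, c * x + s * y) \<partial>lborel \<partial>lborel)
      = (\<integral>\<^sup>+x. \<integral>\<^sup>+y. H2 (x + (- t) * y, y) \<partial>lborel \<partial>lborel)"
    by (simp only: eq)
  also have "\<dots> = (\<integral>\<^sup>+x. \<integral>\<^sup>+y. H2 (x, y) \<partial>lborel \<partial>lborel)"
    by (rule nn_integral_shear_fst) measurable
  also have "\<dots> = (\<integral>\<^sup>+x. \<integral>\<^sup>+y. H1 (x, y) \<partial>lborel \<partial>lborel)"
    unfolding H2_def using nn_integral_shear_snd[of H1 c] by simp
  also have "\<dots> = (\<integral>\<^sup>+x. \<integral>\<^sup>+y. H (x, y) \<partial>lborel \<partial>lborel)"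
    unfolding H1_def using nn_integral_shear_fst[of H "- t"] by simp
  finally show ?thesis .
qed

text \<open>The joint density is a function of \<open>x\<^sup>2 + y\<^sup>2\<close> alone, so
  rotation invariance passes from Lebesgue measure to a pair of independent Gaussians.\<close>

lemma nn_integral_std_gauss_pair:
  assumes [measurable]: "G \<in> borel_measurable (borel \<Otimes>\<^sub>M borel)"
  shows "(\<integral>\<^sup>+x. \<integral>\<^sup>+y. G (x, y) \<partial>std_gauss \<partial>std_gauss)
    = (\<integral>\<^sup>+x. \<integral>\<^sup>+y. ennreal (exp (- (x\<^sup>2 + y\<^sup>2) / 2) / (2 * pi)) * G (x, y) \<partial>lborel \<partial>lborel)"
proof -
  have *: "ennreal (std_normal_density x) * (ennreal (std_normal_density y) * z)
      = ennreal (exp (- (x\<^sup>2 + y\<^sup>2) / 2) / (2 * pi)) * z" for x y z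
  proof -
    have "std_normal_density x * std_normal_density y = exp (- (x\<^sup>2 + y\<^sup>2) / 2) / (2 * pi)"
      by (simp add: std_normal_density_def exp_add[symmetric] field_simps)
    then show ?thesis
      by (simp add: mult.assoc[symmetric] ennreal_mult'[symmetric])
  qed
  show ?thesis
    by (subst nn_integral_std_gauss, simp)
       (simp add: nn_integral_std_gauss nn_integral_cmult[symmetric] *)
qed

lemma nn_integral_std_gauss_rotate:
  assumes [measurable]: "G \<in> borel_measurable (borel \<Otimes>\<^sub>M borel)"
    and sc: "s\<^sup>2 + c\<^sup>2 = 1" and s: "s \<noteq> - 1"
  shows "(\<integral>\<^sup>+x. \<integral>\<^sup>+y. G (s * x - c * y, c * x + s * y) \<partial>std_gauss \<partial>std_gauss)
    = (\<integral>\<^sup>+x. \<integral>\<^sup>+y. G (x, y) \<partial>std_gauss \<partial>std_gauss)"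
proof -
  have n: "(s * x - c * y)\<^sup>2 + (c * x + s * y)\<^sup>2 = x\<^sup>2 + y\<^sup>2" for x y
  proof -
    have "(s * x - c * y)\<^sup>2 + (c * x + s * y)\<^sup>2 = (s\<^sup>2 + c\<^sup>2) * (x\<^sup>2 + y\<^sup>2)"
      by (simp add: power2_eq_square algebra_simps)
    then show ?thesis using sc by simp
  qed
  show ?thesis
    using nn_integral_std_gauss_pair[of "\<lambda>(x, y). G (s * x - c * y, c * x + s * y)"]
      nn_integral_lborel_rotate[of "\<lambda>(x, y). ennreal (exp (- (x\<^sup>2 + y\<^sup>2) / 2) / (2 * pi)) * G (x, y)" s c]
      nn_integral_std_gauss_pair[of G]
    by (simp only: n sc s assms split_conv) (simp add: sc s)
qed

text \<open>A rotation makes \<open>x\<close> the component along the unit vector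
  \<open>(s, c)\<close>. Replacing it by the independent \<open>u\<close> turns the argument of
  \<open>G\<close> into the rotated pair \<open>(u, y)\<close>. The old \<open>x\<close> integrates
  to \<open>1\<close>, and a second use of invariance removes the rotation.\<close>

lemma nn_integral_std_gauss_resample2:
  assumes [measurable]: "G \<in> borel_measurable (borel \<Otimes>\<^sub>M borel)"
    and sc: "s\<^sup>2 + c\<^sup>2 = 1" and s: "s \<noteq> - 1"
  shows "(\<integral>\<^sup>+u. \<integral>\<^sup>+x. \<integral>\<^sup>+y. G (x + (u - (s * x + c * y)) * s, y + (u - (s * x + c * y)) * c)
       \<partial>std_gauss \<partial>std_gauss \<partial>std_gauss)
    = (\<integral>\<^sup>+x. \<integral>\<^sup>+y. G (x, y) \<partial>std_gauss \<partial>std_gauss)"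
proof -
  interpret N: prob_space std_gauss by (rule prob_space_std_gauss)
  have "(\<integral>\<^sup>+x. \<integral>\<^sup>+y. G (x + (u - (s * x + c * y)) * s, y + (u - (s * x + c * y)) * c)
       \<partial>std_gauss \<partial>std_gauss) = (\<integral>\<^sup>+y. G (s * u - c * y, c * u + s * y) \<partial>std_gauss)" for u
  proof -
    let ?K = "\<lambda>(x, y). G (x + (u - (s * x + c * y)) * s, y + (u - (s * x + c * y)) * c)"
    have "?K (s * x - c * y, c * x + s * y) = G (s * u - c * y, c * u + s * y)" for x y
    proof -
      have a: "s * (s * x - c * y) + c * (c * x + s * y) = (s\<^sup>2 + c\<^sup>2) * x"
        by (simp add: power2_eq_square algebra_simps)
      show ?thesis by (simp add: a sc) (simp add: algebra_simps)
    qed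
    then have "(\<integral>\<^sup>+x. \<integral>\<^sup>+y. ?K (x, y) \<partial>std_gauss \<partial>std_gauss)
       = (\<integral>\<^sup>+x. \<integral>\<^sup>+y. G (s * u - c * y, c * u + s * y) \<partial>std_gauss \<partial>std_gauss)"
      using nn_integral_std_gauss_rotate[of ?K s c] sc s by simp
    then show ?thesis by (simp add: N.emeasure_space_1[unfolded space_std_gauss])
  qed
  then show ?thesis using nn_integral_std_gauss_rotate[OF assms] by simp
qed

section \<open>The standard Gaussian vector in \<open>d\<close> dimensions and resampling along a
  direction\<close>

definition gauss :: "nat \<Rightarrow> (nat \<Rightarrow> real) measure" where
  "gauss d = PiM {..<d} (\<lambda>_. std_gauss)"

definition dot :: "nat \<Rightarrow> (nat \<Rightarrow> real) \<Rightarrow> (nat \<Rightarrow> real) \<Rightarrow> real" where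
  "dot d x y = (\<Sum>i<d. x i * y i)"

text \<open>Points of \<open>gauss d\<close> are \<open>undefined\<close> outside
  \<open>{..<d}\<close>, and combinations such as \<open>\<lambda>i. g i + c * b i\<close> leave
  that space. Integrands that ignore the other coordinates can still be evaluated there.\<close>

definition finitary :: "nat \<Rightarrow> ((nat \<Rightarrow> real) \<Rightarrow> 'b) \<Rightarrow> bool" where
  "finitary d F \<longleftrightarrow> (\<forall>x y. (\<forall>i<d. x i = y i) \<longrightarrow> F x = F y)"

lemma finitaryD: "finitary d F \<Longrightarrow> (\<And>i. i < d \<Longrightarrow> x i = y i) \<Longrightarrow> F x = F y"
  by (auto simp: finitary_def)

lemma prob_space_gauss: "prob_space (gauss d)"
  unfolding gauss_def by (intro prob_space_PiM prob_space_std_gauss)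

lemma measurable_gauss_component [measurable]:
  "i < d \<Longrightarrow> (\<lambda>g. g i) \<in> borel_measurable (gauss d)"
  unfolding gauss_def
  using measurable_component_singleton[of i "{..<d}" "\<lambda>_. std_gauss"] by simp

lemma measurable_dot [measurable]:
  assumes "\<And>i. i < d \<Longrightarrow> (\<lambda>x. f x i) \<in> borel_measurable M"
    and "\<And>i. i < d \<Longrightarrow> (\<lambda>x. g x i) \<in> borel_measurable M"
  shows "(\<lambda>x. dot d (f x) (g x)) \<in> borel_measurable M"
  unfolding dot_def using assms by (intro borel_measurable_sum borel_measurable_times) auto

text \<open>Restricting \<open>\<Phi> x\<close> to \<open>{..<d}\<close> lands in the space of
  \<open>gauss d\<close> and does not change the value of \<open>F\<close>.\<close>

lemma measurable_finitary:
  assumes F: "F \<in> borel_measurable (gauss d)" "finitary d F"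
    and \<Phi>: "\<And>i. i < d \<Longrightarrow> (\<lambda>x. \<Phi> x i) \<in> borel_measurable M"
  shows "(\<lambda>x. F (\<Phi> x)) \<in> borel_measurable M"
proof -
  have "(\<lambda>x. \<lambda>i\<in>{..<d}. \<Phi> x i) \<in> measurable M (gauss d)"
    unfolding gauss_def using \<Phi> by (intro measurable_restrict) auto
  from measurable_compose[OF this F(1)]
  have "(\<lambda>x. F (\<lambda>i\<in>{..<d}. \<Phi> x i)) \<in> borel_measurable M" .
  also have "(\<lambda>x. F (\<lambda>i\<in>{..<d}. \<Phi> x i)) = (\<lambda>x. F (\<Phi> x))"
    by (intro ext finitaryD[OF F(2)]) auto
  finally show ?thesis .
qed

lemma nn_integral_gauss_Suc:
  assumes F: "F \<in> borel_measurable (gauss (Suc d))"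
  shows "(\<integral>\<^sup>+g. F g \<partial>gauss (Suc d)) = (\<integral>\<^sup>+g. \<integral>\<^sup>+y. F (g(d := y)) \<partial>std_gauss \<partial>gauss d)"
proof -
  interpret product_sigma_finite "\<lambda>_::nat. std_gauss"
    by (intro product_sigma_finite.intro prob_space_imp_sigma_finite prob_space_std_gauss)
  show ?thesis
    using product_nn_integral_insert[of "{..<d}" d F] F
    by (simp add: gauss_def lessThan_Suc)
qed

lemma measurable_finitary_upd:
  assumes F: "F \<in> borel_measurable (gauss (Suc d))" "finitary (Suc d) F"
    and "f \<in> borel_measurable M"
    and "\<And>i. i < d \<Longrightarrow> (\<lambda>x. \<Phi> x i) \<in> borel_measurable M"
  shows "(\<lambda>x. F ((\<Phi> x)(d := f x))) \<in> borel_measurable M"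
proof (rule measurable_finitary[OF F])
  fix i assume "i < Suc d"
  then show "(\<lambda>x. ((\<Phi> x)(d := f x)) i) \<in> borel_measurable M"
    using assms(3,4) by (cases "i = d") auto
qed

lemma sigma_finite_gauss: "sigma_finite_measure (gauss d)"
  by (intro prob_space_imp_sigma_finite prob_space_gauss)

lemma sigma_finite_std_gauss: "sigma_finite_measure std_gauss"
  by (intro prob_space_imp_sigma_finite prob_space_std_gauss)

lemma nn_integral_gauss_swap:
  assumes "(\<lambda>(x, y). f x y) \<in> borel_measurable (gauss d \<Otimes>\<^sub>M std_gauss)"
  shows "(\<integral>\<^sup>+y. \<integral>\<^sup>+x. f x y \<partial>gauss d \<partial>std_gauss) = (\<integral>\<^sup>+x. \<integral>\<^sup>+y. f x y \<partial>std_gauss \<partial>gauss d)"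
proof -
  interpret P: pair_sigma_finite "gauss d" std_gauss
    by (intro pair_sigma_finite.intro sigma_finite_gauss sigma_finite_std_gauss)
  show ?thesis using P.Fubini'[OF assms] by simp
qed

lemma dot_upd_Suc: "dot (Suc d) b (g(d := y)) = dot d b g + b d * y"
proof -
  have "(\<Sum>i<d. b i * (g(d := y)) i) = (\<Sum>i<d. b i * g i)" by (intro sum.cong) auto
  then show ?thesis by (simp add: dot_def)
qed

lemma finitary_Suc: "finitary (Suc d) F \<Longrightarrow> (\<And>i. i < d \<Longrightarrow> x i = y i) \<Longrightarrow> x d = y d \<Longrightarrow> F x = F y"
  by (rule finitaryD) (auto simp: less_Suc_eq)

text \<open>Induction on the dimension. The first \<open>d\<close> coordinates of \<open>b\<close>
  are \<open>s * e\<close> with \<open>e\<close> of length \<open>1\<close>. By the induction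
  hypothesis the component along \<open>e\<close> may be replaced by an independent Gaussian
  \<open>x\<close>. The component along \<open>b\<close> is then \<open>s * x + b d * y\<close>, so
  the planar case with unit vector \<open>(s, b d)\<close> applies to the pair
  \<open>(x, y)\<close>.\<close>

lemma nn_integral_gauss_resample:
  assumes "F \<in> borel_measurable (gauss d)" "finitary d F" "dot d b b = 1"
  shows "(\<integral>\<^sup>+t. \<integral>\<^sup>+g. F (\<lambda>i. g i + (t - dot d b g) * b i) \<partial>gauss d \<partial>std_gauss)
    = (\<integral>\<^sup>+g. F g \<partial>gauss d)"
  using assms
proof (induction d arbitrary: F b)
  case 0
  then show ?case by (simp add: dot_def)
next
  case (Suc d)
  interpret N: prob_space std_gauss by (rule prob_space_std_gauss)
  note F = Suc.prems(1,2)
  note mF = measurable_finitary_upd[OF F]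
  have bb: "dot d b b + (b d)\<^sup>2 = 1"
    using Suc.prems(3) by (simp add: dot_def power2_eq_square)
  have nn: "0 \<le> dot d b b" by (simp add: dot_def sum_nonneg)
  have step: "(\<integral>\<^sup>+g. F (\<lambda>i. g i + (t - dot (Suc d) b g) * b i) \<partial>gauss (Suc d))
      = (\<integral>\<^sup>+g. \<integral>\<^sup>+y. F (\<lambda>i. (g(d := y)) i + (t - (dot d b g + b d * y)) * b i) \<partial>std_gauss \<partial>gauss d)" for t
    by (subst nn_integral_gauss_Suc) (auto simp: dot_upd_Suc intro!: measurable_finitary[OF F])
  show ?case
  proof (cases "dot d b b = 0")
    case True
    \<comment> \<open>Here \<open>b\<close> is plus or minus the last coordinate vector, so the last
      coordinate becomes \<open>t\<close> or \<open>- t\<close>, which have the same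
      distribution.\<close>
    then have b0: "b i = 0" if "i < d" for i
      using that by (simp add: dot_def sum_nonneg_eq_0_iff)
    then have "dot d b g = 0" for g by (simp add: dot_def)
    from True bb have bd: "b d * b d = 1" by (simp add: power2_eq_square)
    then have "b d = 1 \<or> b d = - 1" using square_eq_1_iff by blast
    have "F (\<lambda>i. (g(d := y)) i + (t - (dot d b g + b d * y)) * b i) = F (g(d := t * b d))" for g y t
      using bd b0 \<open>dot d b g = 0\<close> by (intro finitary_Suc[OF F(2)]) (auto simp: algebra_simps)
    then have "(\<integral>\<^sup>+t. \<integral>\<^sup>+g. F (\<lambda>i. g i + (t - dot (Suc d) b g) * b i) \<partial>gauss (Suc d) \<partial>std_gauss)
        = (\<integral>\<^sup>+t. \<integral>\<^sup>+g. F (g(d := t * b d)) \<partial>gauss d \<partial>std_gauss)"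
      by (simp only: step) (simp add: N.emeasure_space_1[unfolded space_std_gauss])
    also have "\<dots> = (\<integral>\<^sup>+g. \<integral>\<^sup>+t. F (g(d := t * b d)) \<partial>std_gauss \<partial>gauss d)"
      by (rule nn_integral_gauss_swap) (unfold case_prod_beta, rule mF; measurable)
    also have "\<dots> = (\<integral>\<^sup>+g. \<integral>\<^sup>+t. F (g(d := t)) \<partial>std_gauss \<partial>gauss d)"
    proof (rule nn_integral_cong)
      fix g
      have "(\<lambda>t. F (g(d := t))) \<in> borel_measurable borel" by (rule mF; simp)
      then show "(\<integral>\<^sup>+t. F (g(d := t * b d)) \<partial>std_gauss) = (\<integral>\<^sup>+t. F (g(d := t)) \<partial>std_gauss)"
        using \<open>b d = 1 \<or> b d = - 1\<close> nn_integral_std_gauss_uminus[of "\<lambda>t. F (g(d := t))"] by auto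
    qed
    also have "\<dots> = (\<integral>\<^sup>+g. F g \<partial>gauss (Suc d))"
      using F(1) by (rule nn_integral_gauss_Suc[symmetric])
    finally show ?thesis .
  next
    case False
    define s where "s = sqrt (dot d b b)"
    \<comment> \<open>Positivity also excludes \<open>s = - 1\<close>, as planar resampling
      requires.\<close>
    have s: "s > 0" using False nn by (simp add: s_def)
    have s2: "s\<^sup>2 = dot d b b" using nn by (simp add: s_def)
    have sc: "s\<^sup>2 + (b d)\<^sup>2 = 1" using bb s2 by simp
    define e where "e = (\<lambda>i. b i / s)"
    have be: "b i = s * e i" for i using s by (simp add: e_def)
    have dbe: "dot d b g = s * dot d e g" for g
      by (simp add: be dot_def sum_distrib_left mult.assoc)
    have "dot d e e = dot d b b / s\<^sup>2"
      by (simp add: e_def dot_def power2_eq_square sum_divide_distrib[symmetric])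
    then have ee: "dot d e e = 1" using s s2 False by simp
    have de: "dot d e (\<lambda>i. g i + c * e i) = dot d e g + c" for g c
      using ee by (simp add: dot_def algebra_simps sum.distrib sum_distrib_left[symmetric])
    have IH: "(\<integral>\<^sup>+g. G g \<partial>gauss d) = (\<integral>\<^sup>+x. \<integral>\<^sup>+g. G (\<lambda>i. g i + (x - dot d e g) * e i) \<partial>gauss d \<partial>std_gauss)"
      if "G \<in> borel_measurable (gauss d)" "finitary d G" for G
      using Suc.IH[OF that ee] by simp
    define K where "K = (\<lambda>g x y. F ((\<lambda>i. g i + (x - dot d e g) * e i)(d := y)))"
    define A where "A = (\<lambda>t g y. F (\<lambda>i. (g(d := y)) i + (t - (dot d b g + b d * y)) * b i))"
    \<comment> \<open>The shifted vector has component \<open>x\<close> along \<open>e\<close> for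
      every \<open>g\<close>, so the move along \<open>b\<close> only changes \<open>x\<close> and
      \<open>y\<close>.\<close>
    have A_K: "A t (\<lambda>i. g i + (x - dot d e g) * e i) y
        = K g (x + (t - (s * x + b d * y)) * s) (y + (t - (s * x + b d * y)) * b d)" for t g x y
      unfolding A_def K_def dbe de
      by (intro finitary_Suc[OF F(2)]) (auto simp: be algebra_simps)
    have mK [measurable (raw)]: "(\<lambda>w. K (g w) (x w) (y w)) \<in> borel_measurable M"
      if [measurable]: "\<And>i. i < d \<Longrightarrow> (\<lambda>w. g w i) \<in> borel_measurable M"
        "x \<in> borel_measurable M" "y \<in> borel_measurable M"
      for M :: "'c measure" and g x y
      unfolding K_def by (rule mF; measurable)
    have mA [measurable (raw)]: "(\<lambda>w. A (t w) (g w) (y w)) \<in> borel_measurable M"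
      if [measurable]: "\<And>i. i < d \<Longrightarrow> (\<lambda>w. g w i) \<in> borel_measurable M"
        "t \<in> borel_measurable M" "y \<in> borel_measurable M"
      for M :: "'c measure" and g t y
    proof -
      have "(\<lambda>w. ((g w)(d := y w)) i) \<in> borel_measurable M" if "i < Suc d" for i
        using that by (cases "i = d") auto
      moreover have "(\<lambda>w. (t w - (dot d b (g w) + b d * y w)) * c) \<in> borel_measurable M" for c
        by measurable
      ultimately show ?thesis
        unfolding A_def by (intro measurable_finitary[OF F] borel_measurable_add) auto
    qed
    have "(\<integral>\<^sup>+t. \<integral>\<^sup>+g. F (\<lambda>i. g i + (t - dot (Suc d) b g) * b i) \<partial>gauss (Suc d) \<partial>std_gauss)
        = (\<integral>\<^sup>+t. \<integral>\<^sup>+g. \<integral>\<^sup>+y. A t g y \<partial>std_gauss \<partial>gauss d \<partial>std_gauss)"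
      by (simp only: step A_def)
    also have "\<dots> = (\<integral>\<^sup>+t. \<integral>\<^sup>+x. \<integral>\<^sup>+g. \<integral>\<^sup>+y. A t (\<lambda>i. g i + (x - dot d e g) * e i) y \<partial>std_gauss \<partial>gauss d \<partial>std_gauss \<partial>std_gauss)"
    proof (rule nn_integral_cong)
      fix t
      have "finitary d (\<lambda>g. \<integral>\<^sup>+y. A t g y \<partial>std_gauss)"
        unfolding finitary_def A_def
        by (auto intro!: nn_integral_cong finitary_Suc[OF F(2)] simp: dot_def)
      from IH[OF _ this]
      show "(\<integral>\<^sup>+g. \<integral>\<^sup>+y. A t g y \<partial>std_gauss \<partial>gauss d)
        = (\<integral>\<^sup>+x. \<integral>\<^sup>+g. \<integral>\<^sup>+y. A t (\<lambda>i. g i + (x - dot d e g) * e i) y \<partial>std_gauss \<partial>gauss d \<partial>std_gauss)"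
        by measurable
    qed
    also have "\<dots> = (\<integral>\<^sup>+g. \<integral>\<^sup>+t. \<integral>\<^sup>+x. \<integral>\<^sup>+y. K g (x + (t - (s * x + b d * y)) * s) (y + (t - (s * x + b d * y)) * b d) \<partial>std_gauss \<partial>std_gauss \<partial>std_gauss \<partial>gauss d)"
      unfolding A_K
      by (subst nn_integral_gauss_swap, measurable)+
    also have "\<dots> = (\<integral>\<^sup>+g. \<integral>\<^sup>+x. \<integral>\<^sup>+y. K g x y \<partial>std_gauss \<partial>std_gauss \<partial>gauss d)"
    proof (rule nn_integral_cong)
      fix g
      have "(\<lambda>(x, y). K g x y) \<in> borel_measurable (borel \<Otimes>\<^sub>M borel)" by measurable
      from nn_integral_std_gauss_resample2[OF this sc] s
      show "(\<integral>\<^sup>+t. \<integral>\<^sup>+x. \<integral>\<^sup>+y. K g (x + (t - (s * x + b d * y)) * s) (y + (t - (s * x + b d * y)) * b d)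
            \<partial>std_gauss \<partial>std_gauss \<partial>std_gauss)
          = (\<integral>\<^sup>+x. \<integral>\<^sup>+y. K g x y \<partial>std_gauss \<partial>std_gauss)"
        by simp
    qed
    also have "\<dots> = (\<integral>\<^sup>+x. \<integral>\<^sup>+g. \<integral>\<^sup>+y. K g x y \<partial>std_gauss \<partial>gauss d \<partial>std_gauss)"
      by (rule nn_integral_gauss_swap[symmetric]) measurable
    \<comment> \<open>The induction hypothesis, read backwards, removes \<open>x\<close>
      again.\<close>
    also have "\<dots> = (\<integral>\<^sup>+g. \<integral>\<^sup>+y. F (g(d := y)) \<partial>std_gauss \<partial>gauss d)"
      unfolding K_def
    proof (rule IH[symmetric])
      show "finitary d (\<lambda>g. \<integral>\<^sup>+y. F (g(d := y)) \<partial>std_gauss)"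
        unfolding finitary_def
        by (auto intro!: nn_integral_cong finitary_Suc[OF F(2)])
    qed (rule N.borel_measurable_nn_integral, unfold case_prod_beta, rule mF; measurable)
    also have "\<dots> = (\<integral>\<^sup>+g. F g \<partial>gauss (Suc d))"
      using F(1) by (rule nn_integral_gauss_Suc[symmetric])
    finally show ?thesis .
  qed
qed

subsection \<open>Adaptive linear measurements of a Gaussian vector\<close>

text \<open>
  The nested quantifiers encode adaptivity: \<open>v\<close> is chosen anew on every fibre of the earlier
  measurements.
\<close>

primrec decided :: "nat \<Rightarrow> nat \<Rightarrow> (nat \<Rightarrow> real) set \<Rightarrow> ((nat \<Rightarrow> real) \<Rightarrow> 'b) \<Rightarrow> bool" where
  "decided d 0 S f \<longleftrightarrow> (\<forall>x\<in>S. \<forall>y\<in>S. f x = f y)"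
| "decided d (Suc k) S f \<longleftrightarrow> (\<exists>v. \<forall>t. decided d k {x \<in> S. dot d v x = t} f)"

lemma decided_subset: "decided d k S f \<Longrightarrow> S' \<subseteq> S \<Longrightarrow> decided d k S' f"
proof (induction k arbitrary: S S')
  case 0
  then show ?case by auto
next
  case (Suc k)
  from Suc.prems(1) obtain v where v: "\<And>t. decided d k {x \<in> S. dot d v x = t} f" by auto
  have "decided d k {x \<in> S'. dot d v x = t} f" for t
    by (rule Suc.IH[OF v[of t]]) (use Suc.prems(2) in auto)
  then show ?case by auto
qed

lemma decided_empty: "decided d k {} f"
  by (induction k) auto

text \<open>An affine \<open>\<Phi>\<close> turns a measurement of \<open>\<Phi> x\<close> into a
  measurement of \<open>x\<close> with its answer shifted by a constant. The adaptive strategy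
  therefore carries over with the same number of measurements.\<close>

lemma decided_comp:
  assumes "decided d k S f" "\<Phi> ` S' \<subseteq> S"
    and "\<And>v. \<exists>v' c. \<forall>x. dot d v (\<Phi> x) = dot d v' x + c"
  shows "decided d k S' (\<lambda>x. f (\<Phi> x))"
  using assms(1,2)
proof (induction k arbitrary: S S')
  case 0
  then show ?case by (simp add: image_subset_iff)
next
  case (Suc k)
  from Suc.prems(1) obtain v where v: "\<And>t. decided d k {x \<in> S. dot d v x = t} f" by auto
  obtain v' c where v': "\<And>x. dot d v (\<Phi> x) = dot d v' x + c" using assms(3) by blast
  have "decided d k {x \<in> S'. dot d v' x = t} (\<lambda>x. f (\<Phi> x))" for t
    by (rule Suc.IH[OF v[of "t + c"]]) (use Suc.prems(2) v' in auto)
  then show ?case by auto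
qed

lemma dot_add_right: "dot d v (\<lambda>i. x i + y i) = dot d v x + dot d v y"
  by (simp add: dot_def algebra_simps sum.distrib)

lemma dot_scale_right: "dot d v (\<lambda>i. c * x i) = c * dot d v x"
  by (simp add: dot_def sum_distrib_left mult_ac)

lemma dot_commute: "dot d x y = dot d y x"
  by (simp add: dot_def mult.commute)

lemma dot_shift_right: "dot d v (\<lambda>i. x i + c * b i) = dot d v x + c * dot d v b"
  by (simp add: dot_add_right dot_scale_right)

lemma dot_shift_left: "dot d (\<lambda>i. x i + c * b i) v = dot d x v + c * dot d b v"
  using dot_shift_right[of d v x c b] by (simp add: dot_commute)

lemma dot_self_nonneg: "0 \<le> dot d x x"
  by (simp add: dot_def sum_nonneg)

lemma nn_integral_std_gauss_square: "(\<integral>\<^sup>+t. ennreal (t\<^sup>2) \<partial>std_gauss) = 1"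
proof -
  have "has_bochner_integral lborel (\<lambda>x. std_normal_density x * x ^ (2 * 1)) (fact (2 * 1) / (2 ^ 1 * fact 1))"
    by (rule std_normal_moment_even)
  then have "has_bochner_integral lborel (\<lambda>x. std_normal_density x * x\<^sup>2) 1" by simp
  then have "(\<integral>\<^sup>+x. ennreal (std_normal_density x * x\<^sup>2) \<partial>lborel) = 1"
    by (subst nn_integral_eq_integral) (auto simp: has_bochner_integral_iff)
  then show ?thesis by (simp add: nn_integral_std_gauss ennreal_mult')
qed

text \<open>
  Resampling \<open>g\<close> along the first measured direction \<open>b\<close> makes its component \<open>t\<close> there an independent
  coordinate; for each \<open>t\<close> the resampled function is decided by one measurement fewer, at the price
  of raising \<open>c\<close> by \<open>t\<^sup>2\<close>, whose expectation is \<open>1\<close>.  The constant function reached in the end is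
  bounded by its value at \<open>0\<close>, hence by \<open>c\<close>.
\<close>

lemma nn_integral_decided_le:
  assumes "f \<in> borel_measurable (gauss d)" "finitary d f"
    and "decided d k UNIV f" "0 \<le> c" "\<And>g. f g \<le> ennreal (c + dot d g g)"
  shows "(\<integral>\<^sup>+g. f g \<partial>gauss d) \<le> ennreal (c + real k)"
  using assms
proof (induction k arbitrary: f c)
  case 0
  interpret prob_space "gauss d" by (rule prob_space_gauss)
  have "f g = f (\<lambda>_. 0)" for g using 0(3) by simp
  moreover have "f (\<lambda>_. 0) \<le> ennreal c" using 0(5)[of "\<lambda>_. 0"] by (simp add: dot_def)
  ultimately have "f g \<le> ennreal c" for g by metis
  then have "(\<integral>\<^sup>+g. f g \<partial>gauss d) \<le> (\<integral>\<^sup>+g. ennreal c \<partial>gauss d)" by (intro nn_integral_mono)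
  then show ?case by (simp add: emeasure_space_1)
next
  case (Suc k)
  interpret N: prob_space std_gauss by (rule prob_space_std_gauss)
  from Suc.prems(3) obtain v where v: "\<And>t. decided d k {x. dot d v x = t} f" by auto
  show ?case
  proof (cases "dot d v v = 0")
    case True
    \<comment> \<open>A direction of length \<open>0\<close> measures nothing: its fibre over
      \<open>0\<close> is the whole space, so one measurement is saved.\<close>
    then have "v i = 0" if "i < d" for i
      using that by (simp add: dot_def sum_nonneg_eq_0_iff)
    then have "dot d v x = 0" for x by (simp add: dot_def)
    then have "decided d k UNIV f" using v[of 0] by simp
    then have "(\<integral>\<^sup>+g. f g \<partial>gauss d) \<le> ennreal (c + real k)" by (intro Suc.IH Suc.prems)
    also have "\<dots> \<le> ennreal (c + real (Suc k))" using Suc.prems(4) by (intro ennreal_leI) simp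
    finally show ?thesis .
  next
    case False
    define s where "s = sqrt (dot d v v)"
    have s: "s > 0" "s * s = dot d v v" using False dot_self_nonneg[of d v] by (simp_all add: s_def)
    define b where "b = (\<lambda>i. (1 / s) * v i)"
    have vb: "dot d v b = s" unfolding b_def dot_scale_right using s by (simp add: field_simps)
    have bv: "dot d v x = s * dot d b x" for x
      using s by (simp add: b_def dot_def sum_distrib_left)
    have bb: "dot d b b = 1" using bv[of b] vb s by simp
    define \<Phi> where "\<Phi> = (\<lambda>t g i. g i + (t - dot d b g) * b i)"
    have "(\<integral>\<^sup>+g. f g \<partial>gauss d) = (\<integral>\<^sup>+t. \<integral>\<^sup>+g. f (\<Phi> t g) \<partial>gauss d \<partial>std_gauss)"
      unfolding \<Phi>_def by (rule nn_integral_gauss_resample[OF Suc.prems(1,2) bb, symmetric])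
    also have "\<dots> \<le> (\<integral>\<^sup>+t. ennreal (c + t\<^sup>2 + real k) \<partial>std_gauss)"
    proof (intro nn_integral_mono Suc.IH)
      fix t
      show "(\<lambda>g. f (\<Phi> t g)) \<in> borel_measurable (gauss d)"
        unfolding \<Phi>_def by (rule measurable_finitary[OF Suc.prems(1,2)]) measurable
      show "finitary d (\<lambda>g. f (\<Phi> t g))"
        unfolding finitary_def by (auto intro!: finitaryD[OF Suc.prems(2)] simp: \<Phi>_def dot_def)
      show "decided d k UNIV (\<lambda>g. f (\<Phi> t g))"
      \<comment> \<open>After resampling, the first measurement always returns \<open>s * t\<close>,
        so the strategy continues inside a single fibre.\<close>
      proof (rule decided_comp[OF v[of "s * t"]])
        show "range (\<Phi> t) \<subseteq> {x. dot d v x = s * t}"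
          by (auto simp: bv \<Phi>_def dot_shift_right bb)
      next
        fix w
        \<comment> \<open>A later direction \<open>w\<close> acts on \<open>x\<close> through its
          part orthogonal to \<open>b\<close>; the rest contributes a constant.\<close>
        have "dot d w (\<Phi> t x) = dot d (\<lambda>i. w i + (- dot d w b) * b i) x + t * dot d w b" for x
          by (simp only: \<Phi>_def dot_shift_right dot_shift_left) (simp add: algebra_simps)
        then show "\<exists>w' e. \<forall>x. dot d w (\<Phi> t x) = dot d w' x + e" by blast
      qed
      show "0 \<le> c + t\<^sup>2" using Suc.prems(4) by simp
      fix g
      \<comment> \<open>Pythagoras: the squared component along \<open>b\<close> is exchanged for
        \<open>t\<^sup>2\<close>.\<close>
      have "dot d (\<Phi> t g) (\<Phi> t g) = dot d g g - (dot d b g)\<^sup>2 + t\<^sup>2"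
        by (simp add: \<Phi>_def dot_shift_right dot_shift_left dot_commute[of d g b] bb)
           (simp add: power2_eq_square algebra_simps)
      then show "f (\<Phi> t g) \<le> ennreal (c + t\<^sup>2 + dot d g g)"
        by (intro order.trans[OF Suc.prems(5)] ennreal_leI) simp
    qed
    also have "\<dots> = (\<integral>\<^sup>+t. ennreal (c + real k) + ennreal (t\<^sup>2) \<partial>std_gauss)"
      using Suc.prems(4) by (intro nn_integral_cong) (simp add: ennreal_plus[symmetric] add_ac del: ennreal_plus)
    also have "\<dots> = ennreal (c + real k) + 1"
    proof -
      have "(\<lambda>t::real. t\<^sup>2) \<in> borel_measurable borel"
        by (intro borel_measurable_continuous_onI continuous_intros)
      from measurable_compose[OF this measurable_ennreal]
      have m: "(\<lambda>t. ennreal (t\<^sup>2)) \<in> borel_measurable std_gauss"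
        unfolding measurable_cong_sets[OF sets_std_gauss refl] .
      show ?thesis
        using N.emeasure_space_1
        by (simp add: nn_integral_add[OF borel_measurable_const m] nn_integral_std_gauss_square)
    qed
    also have "\<dots> = ennreal (c + real (Suc k))"
      using Suc.prems(4) by (simp add: ennreal_plus[symmetric] ennreal_1[symmetric] add_ac del: ennreal_plus ennreal_1)
    finally show ?thesis .
  qed
qed

subsection \<open>Rank-one perturbations of the identity\<close>

definition spike :: "nat \<Rightarrow> real \<Rightarrow> (nat \<Rightarrow> real) \<Rightarrow> real mat" where
  "spike d \<mu> g = mat d d (\<lambda>(i, j). (if i = j then 1 else 0) - \<mu> * g i * g j)"

lemma spike_carrier [simp]: "spike d \<mu> g \<in> carrier_mat d d"
  by (simp add: spike_def)

lemma dim_spike [simp]: "dim_row (spike d \<mu> g) = d" "dim_col (spike d \<mu> g) = d"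
  by (simp_all add: spike_def)

lemma transpose_spike [simp]: "transpose_mat (spike d \<mu> g) = spike d \<mu> g"
  by (rule eq_matI) (auto simp: spike_def)

lemma spike_in_sym_mats [simp]: "spike d \<mu> g \<in> sym_mats d"
  by (simp add: sym_mats_def)

lemma scalar_prod_dot: "w \<in> carrier_vec d \<Longrightarrow> v \<bullet> w = dot d (($) v) (($) w)"
  by (simp add: scalar_prod_def dot_def atLeast0LessThan)

lemma spike_mult_vec:
  assumes "w \<in> carrier_vec d" "i < d"
  shows "(spike d \<mu> g *\<^sub>v w) $ i = w $ i - \<mu> * g i * dot d g (($) w)"
proof -
  have "(spike d \<mu> g *\<^sub>v w) $ i = (\<Sum>j<d. ((if i = j then 1 else 0) - \<mu> * g i * g j) * w $ j)"
    using assms by (simp add: spike_def scalar_prod_def atLeast0LessThan)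
  also have "\<dots> = (\<Sum>j<d. (if j = i then w $ j else 0) - \<mu> * g i * (g j * w $ j))"
    by (intro sum.cong) (auto simp: algebra_simps)
  also have "\<dots> = w $ i - \<mu> * g i * dot d g (($) w)"
    using assms(2) by (simp add: sum_subtractf sum.delta sum_distrib_left dot_def)
  finally show ?thesis .
qed

text \<open>This is the link to adaptive measurements: an answer depends on \<open>g\<close> only
  through its products with \<open>v\<close> and \<open>w\<close>.\<close>

lemma spike_bilinear:
  assumes "v \<in> carrier_vec d" "w \<in> carrier_vec d"
  shows "v \<bullet> (spike d \<mu> g *\<^sub>v w)
    = dot d (($) v) (($) w) - \<mu> * (dot d (($) v) g * dot d (($) w) g)"
proof -
  have "spike d \<mu> g *\<^sub>v w \<in> carrier_vec d"
    using assms(2) by (rule mult_mat_vec_carrier[OF spike_carrier])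
  then have "v \<bullet> (spike d \<mu> g *\<^sub>v w) = dot d (($) v) (($) (spike d \<mu> g *\<^sub>v w))"
    by (rule scalar_prod_dot)
  also have "\<dots> = dot d (($) v) (\<lambda>i. w $ i + (- \<mu> * dot d g (($) w)) * g i)"
    unfolding dot_def using assms(2)
    by (intro sum.cong refl) (simp add: spike_mult_vec dot_def[symmetric] del: index_mult_mat_vec)
  finally show ?thesis by (simp only: dot_shift_right) (simp add: dot_commute)
qed

lemma dot_Cauchy_Schwarz: "(dot d x y)\<^sup>2 \<le> dot d x x * dot d y y"
  using Cauchy_Schwarz_ineq_sum[of x y "{..<d}"] by (simp add: dot_def power2_eq_square)

text \<open>By Cauchy-Schwarz the subtracted rank-one form is at most
  \<open>\<mu> * dot d g g\<close> times the squared length of \<open>v\<close>.\<close>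

lemma spike_in_psd_mats:
  assumes "0 \<le> \<mu>" "\<mu> * dot d g g \<le> 1"
  shows "spike d \<mu> g \<in> psd_mats d"
proof -
  have "0 \<le> v \<bullet> (spike d \<mu> g *\<^sub>v v)" if v: "v \<in> carrier_vec d" for v
  proof -
    have "\<mu> * (dot d (($) v) g)\<^sup>2 \<le> \<mu> * (dot d (($) v) (($) v) * dot d g g)"
      using assms(1) dot_Cauchy_Schwarz by (intro mult_left_mono)
    also have "\<dots> = dot d (($) v) (($) v) * (\<mu> * dot d g g)" by simp
    also have "\<dots> \<le> dot d (($) v) (($) v) * 1"
      using assms(2) dot_self_nonneg by (intro mult_left_mono)
    finally show ?thesis using spike_bilinear[OF v v] by (simp add: power2_eq_square)
  qed
  then show ?thesis by (simp add: psd_mats_def)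
qed

lemma dot_vec: "dot d (($) (vec d g)) x = dot d g x" "dot d x (($) (vec d g)) = dot d x g"
  by (auto simp: dot_def intro!: sum.cong)

text \<open>The quadratic form is negative at \<open>g\<close> itself.\<close>

lemma spike_notin_psd_mats:
  assumes "\<mu> * dot d g g > 1"
  shows "spike d \<mu> g \<notin> psd_mats d"
proof
  assume "spike d \<mu> g \<in> psd_mats d"
  then have "0 \<le> vec d g \<bullet> (spike d \<mu> g *\<^sub>v vec d g)" by (simp add: psd_mats_def)
  also have "\<dots> = dot d g g * (1 - \<mu> * dot d g g)"
    by (simp add: spike_bilinear dot_vec algebra_simps)
  finally have "dot d g g = 0"
    using assms dot_self_nonneg[of d g] by (simp add: zero_le_mult_iff)
  then show False using assms by simp
qed

text \<open>The vector \<open>g\<close> is an eigenvector for the value on the right, and one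
  eigenvalue bounds the minimum of the finite spectrum from above.\<close>

lemma lambda_min_spike_le:
  assumes "\<mu> * dot d g g > 1"
  shows "lambda_min (spike d \<mu> g) \<le> 1 - \<mu> * dot d g g"
proof -
  have "spike d \<mu> g *\<^sub>v vec d g = (1 - \<mu> * dot d g g) \<cdot>\<^sub>v vec d g"
    by (rule eq_vecI) (simp_all add: spike_mult_vec dot_vec algebra_simps del: index_mult_mat_vec)
  moreover have "vec d g \<noteq> 0\<^sub>v d"
  proof
    assume "vec d g = 0\<^sub>v d"
    then have "g i = 0" if "i < d" for i using that by (metis index_vec index_zero_vec(1))
    then have "dot d g g = 0" by (simp add: dot_def)
    then show False using assms by simp
  qed
  ultimately have "eigenvalue (spike d \<mu> g) (1 - \<mu> * dot d g g)"
    unfolding eigenvalue_def eigenvector_def by (intro exI[of _ "vec d g"]) simp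
  moreover have "finite (spectrum (spike d \<mu> g))"
    using card_finite_spectrum[OF spike_carrier] by simp
  ultimately show ?thesis by (simp add: lambda_min_def spectrum_def)
qed

section \<open>Characteristic polynomial, singular values and Schatten norm\<close>

text \<open>Since the matrix is symmetric, this is its Gram matrix. It has the same shape, so one
  characteristic polynomial formula gives all singular values.\<close>

lemma spike_square:
  "spike d \<mu> g * spike d \<mu> g = spike d (2 * \<mu> - \<mu>\<^sup>2 * dot d g g) g"
proof (rule eq_matI)
  fix i j assume ij: "i < dim_row (spike d (2 * \<mu> - \<mu>\<^sup>2 * dot d g g) g)"
    "j < dim_col (spike d (2 * \<mu> - \<mu>\<^sup>2 * dot d g g) g)"
  let ?c = "col (spike d \<mu> g) j"
  have c: "?c $ k = (if k = j then 1 else 0) - \<mu> * g j * g k" if "k < d" for k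
    using that ij by (simp add: spike_def)
  have "dot d g (($) ?c) = (\<Sum>k<d. (if k = j then g k else 0) - \<mu> * g j * (g k * g k))"
    unfolding dot_def using ij by (intro sum.cong) (auto simp: spike_def algebra_simps)
  then have "dot d g (($) ?c) = g j - \<mu> * g j * dot d g g"
    using ij by (simp add: sum_subtractf sum.delta sum_distrib_left dot_def)
  moreover have "(spike d \<mu> g * spike d \<mu> g) $$ (i, j) = (spike d \<mu> g *\<^sub>v ?c) $ i"
    using ij by simp
  ultimately show "(spike d \<mu> g * spike d \<mu> g) $$ (i, j) = spike d (2 * \<mu> - \<mu>\<^sup>2 * dot d g g) g $$ (i, j)"
    using ij c by (simp add: spike_mult_vec carrier_vecI del: index_mult_mat_vec index_mult_mat)
      (simp add: spike_def power2_eq_square algebra_simps)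
qed simp_all

text \<open>The matrix determinant lemma. The bordered matrix with blocks \<open>1\<close>,
  \<open>W\<close>, \<open>U\<close> and \<open>y\<close> times the identity has Schur complement
  \<open>M\<close> with respect to the corner and \<open>R\<close> with respect to the large block.
  Eliminating either way gives the same determinant.\<close>

lemma det_scalar_plus_rank_one:
  fixes y :: "'a :: field"
  assumes y: "y \<noteq> 0"
  shows "det (mat d d (\<lambda>(i, j). (if i = j then y else 0) + u i * w j))
    = y ^ d * (1 + (\<Sum>i<d. u i * w i) / y)"
proof -
  define U where "U = mat d 1 (\<lambda>(i, j). u i)"
  define W where "W = mat 1 d (\<lambda>(i, j). - w j)"
  define V where "V = mat d 1 (\<lambda>(i, j). - u i / y)"
  define M where "M = mat d d (\<lambda>(i, j). (if i = j then y else 0) + u i * w j)"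
  define R where "R = mat 1 1 (\<lambda>_. 1 + (\<Sum>i<d. u i * w i) / y)"
  have c [simp]: "U \<in> carrier_mat d 1" "W \<in> carrier_mat 1 d" "V \<in> carrier_mat d 1"
    "M \<in> carrier_mat d d" "R \<in> carrier_mat 1 1"
    by (simp_all add: U_def V_def W_def M_def R_def)
  let ?I = "1\<^sub>m d" and ?Y = "y \<cdot>\<^sub>m 1\<^sub>m d" and ?J = "1\<^sub>m 1"
  have UW: "U * W + M = ?Y"
    by (rule eq_matI) (auto simp: U_def W_def M_def scalar_prod_def)
  have WV: "?J + W * V = R"
    by (rule eq_matI) (auto simp: V_def W_def R_def scalar_prod_def atLeast0LessThan sum_divide_distrib mult.commute)
  have UV: "U + ?Y * V = 0\<^sub>m d 1"
    by (rule eq_matI) (use y in \<open>auto simp: U_def V_def\<close>)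
  have "four_block_mat ?J (0\<^sub>m 1 d) U ?I * four_block_mat ?J W (0\<^sub>m d 1) M
      = four_block_mat ?J W U ?Y"
    using mult_four_block_mat[OF one_carrier_mat zero_carrier_mat c(1) one_carrier_mat
        one_carrier_mat c(2) zero_carrier_mat c(4)]
    by (simp add: UW left_mult_one_mat[OF c(2)] left_mult_one_mat[OF c(4)] left_mult_zero_mat[OF c(4)]
        right_mult_one_mat[OF c(1)] right_add_zero_mat[OF c(1)] right_add_zero_mat[OF c(2)] del: One_nat_def)
  moreover have "four_block_mat ?J W U ?Y * four_block_mat ?J (0\<^sub>m 1 d) V ?I
      = four_block_mat R W (0\<^sub>m d 1) ?Y"
    using mult_four_block_mat[OF one_carrier_mat c(2,1) smult_carrier_mat[OF one_carrier_mat]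
        one_carrier_mat zero_carrier_mat c(3) one_carrier_mat]
    by (simp add: WV UV right_mult_one_mat[OF c(2)] left_add_zero_mat[OF c(2)]
        right_mult_zero_mat[OF c(1)] right_mult_one_mat[OF c(1)] del: One_nat_def)
  moreover have "det (four_block_mat ?J (0\<^sub>m 1 d) X ?I) = 1" if "X \<in> carrier_mat d 1"
    for X :: "'a mat"
    by (simp add: det_four_block_mat_upper_right_zero[OF one_carrier_mat refl that one_carrier_mat] del: One_nat_def)
  moreover have "det (four_block_mat ?J W (0\<^sub>m d 1) M) = det M"
    by (simp add: det_four_block_mat_lower_left_zero[OF one_carrier_mat c(2) refl c(4)] del: One_nat_def)
  moreover have "det (four_block_mat R W (0\<^sub>m d 1) ?Y) = R $$ (0, 0) * y ^ d"
    by (simp add: det_four_block_mat_lower_left_zero[OF c(5,2) refl smult_carrier_mat[OF one_carrier_mat]]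
        det_single[OF c(5)] del: One_nat_def)
  moreover have "four_block_mat ?J W U ?Y \<in> carrier_mat (1 + d) (1 + d)"
    "four_block_mat ?J (0\<^sub>m 1 d) V ?I \<in> carrier_mat (1 + d) (1 + d)"
    "four_block_mat ?J (0\<^sub>m 1 d) U ?I \<in> carrier_mat (1 + d) (1 + d)"
    "four_block_mat ?J W (0\<^sub>m d 1) M \<in> carrier_mat (1 + d) (1 + d)"
    by (intro four_block_carrier_mat; simp)+
  ultimately have "det M = R $$ (0, 0) * y ^ d"
    by (metis c(1,3) det_mult mult.right_neutral mult_1)
  then show ?thesis by (simp add: M_def R_def mult.commute)
qed

text \<open>The determinant formula with \<open>y = k - 1\<close> covers all
  \<open>k \<noteq> 1\<close>. The extra factor \<open>[:-1, 1:]\<close> makes both sides vanish at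
  \<open>1\<close> as well, so they agree as polynomials and the factor cancels.\<close>

lemma char_poly_spike:
  assumes "d \<ge> 1"
  shows "char_poly (spike d \<nu> g) = [:-1, 1:] ^ (d - 1) * [:- (1 - \<nu> * dot d g g), 1:]"
proof -
  have "poly ([:-1, 1:] * char_poly (spike d \<nu> g)) k
      = poly ([:-1, 1:] * ([:-1, 1:] ^ (d - 1) * [:- (1 - \<nu> * dot d g g), 1:])) k" for k
  proof (cases "k = 1")
    case False
    have "- char_matrix (spike d \<nu> g) k
        = mat d d (\<lambda>(i, j). (if i = j then k - 1 else 0) + \<nu> * g i * g j)"
      by (rule eq_matI) (auto simp: char_matrix_def spike_def)
    then have "poly (char_poly (spike d \<nu> g)) k = (k - 1) ^ d * (1 + \<nu> * dot d g g / (k - 1))"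
      using det_scalar_plus_rank_one[of "k - 1" d "\<lambda>i. \<nu> * g i" g] False
      by (simp add: char_poly_matrix[OF spike_carrier] dot_def sum_distrib_left mult.assoc)
    also have "\<dots> = (k - 1) ^ (d - 1) * (k - (1 - \<nu> * dot d g g))"
      using assms False by (cases d) (simp_all add: field_simps)
    finally have "poly (char_poly (spike d \<nu> g)) k
        = poly ([:-1, 1:] ^ (d - 1) * [:- (1 - \<nu> * dot d g g), 1:]) k"
      by (simp add: poly_power algebra_simps)
    then show ?thesis by (simp only: poly_mult)
  qed simp
  then have "[:-1, 1:] * char_poly (spike d \<nu> g)
      = [:-1, 1:] * ([:-1, 1:] ^ (d - 1) * [:- (1 - \<nu> * dot d g g), 1:])"
    by (simp only: poly_eq_poly_eq_iff[symmetric] fun_eq_iff) simp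
  then show ?thesis by (subst (asm) mult_cancel_left) simp
qed

text \<open>The eigenvalue of the Gram matrix in direction \<open>g\<close> is the square of
  \<open>1 - \<mu> * dot d g g\<close>; all other eigenvalues are \<open>1\<close>.\<close>

lemma singular_values_spike:
  assumes "d \<ge> 1"
  shows "singular_values (spike d \<mu> g) = add_mset \<bar>1 - \<mu> * dot d g g\<bar> (replicate_mset (d - 1) 1)"
proof -
  have "1 - (2 * \<mu> - \<mu>\<^sup>2 * dot d g g) * dot d g g = (1 - \<mu> * dot d g g)\<^sup>2"
    by (simp add: power2_eq_square algebra_simps)
  moreover have "proots ([:-1, 1:] ^ (d - 1) * [:- a, 1:]) = add_mset a (replicate_mset (d - 1) 1)"
    for a :: real
    by (subst proots_mult) (simp_all add: proots_power repeat_mset_right del: mult_pCons_right)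
  ultimately show ?thesis
    using assms by (simp only: singular_values_def transpose_spike spike_square char_poly_spike) simp
qed

text \<open>On the interval from \<open>0\<close> to \<open>s = x + y\<close> the power lies below
  its chord \<open>s powr r * (z / s)\<close>, and the chord values at \<open>x\<close> and
  \<open>y\<close> add up to \<open>s powr r\<close>.\<close>

lemma powr_superadditive:
  fixes x y r :: real
  assumes "0 \<le> x" "0 \<le> y" "1 \<le> r"
  shows "x powr r + y powr r \<le> (x + y) powr r"
proof (cases "x + y = 0")
  case False
  define s where "s = x + y"
  have s: "s > 0" using False assms by (simp add: s_def)
  have *: "z powr r \<le> s powr r * (z / s)" if "0 \<le> z" "z \<le> s" for z
  proof -
    have "(z / s) powr r \<le> (z / s) powr 1" using that s assms(3) by (intro powr_mono') auto
    then have "s powr r * (z / s) powr r \<le> s powr r * (z / s)"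
      using that s by (intro mult_left_mono) auto
    then show ?thesis using that s by (simp add: powr_divide)
  qed
  have "x powr r + y powr r \<le> s powr r * (x / s) + s powr r * (y / s)"
    using assms by (intro add_mono *) (auto simp: s_def)
  also have "\<dots> = s powr r * ((x + y) / s)" by (simp add: add_divide_distrib distrib_left)
  finally show ?thesis using s by (simp add: s_def)
next
  case True
  then have "x = 0" "y = 0" using assms by linarith+
  then show ?thesis by simp
qed

text \<open>A triangle inequality: the \<open>d - 1\<close> singular values \<open>1\<close>
  contribute at most the first summand, the remaining singular value contributes the second. For
  finite \<open>p\<close> it follows from superadditivity of the power; for
  \<open>p = \<infinity>\<close> the first summand is \<open>1\<close>.\<close>

lemma schatten_norm_spike_le:
  assumes p: "1 \<le> p" and d: "1 \<le> d" and m: "\<mu> * dot d g g \<ge> 1"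
  shows "schatten_norm p (spike d \<mu> g)
    \<le> real d powr real_of_ereal (1 / p) + (\<mu> * dot d g g - 1)"
proof (cases "p = \<infinity>")
  case True
  then show ?thesis
    using d m by (auto simp: schatten_norm_def singular_values_spike Max_insert2 intro!: Max.boundedI)
next
  case False
  then obtain r where r: "p = ereal r" "r \<ge> 1" using p by (cases p) auto
  define t where "t = \<mu> * dot d g g - 1"
  have t: "t \<ge> 0" "\<bar>1 - \<mu> * dot d g g\<bar> = t" using m by (simp_all add: t_def)
  define k where "k = real d powr (1 / r)"
  have k: "k \<ge> 0" "k powr r = real d" using r d by (simp_all add: k_def powr_powr)
  have "schatten_norm p (spike d \<mu> g) = (t powr r + real (d - 1)) powr (1 / r)"
    using d r by (simp add: schatten_norm_def singular_values_spike t(2))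
  also have "\<dots> \<le> ((k + t) powr r) powr (1 / r)"
  proof (rule powr_mono2)
    have "t powr r + real (d - 1) \<le> t powr r + k powr r" using k by simp
    also have "\<dots> \<le> (k + t) powr r"
      using powr_superadditive[of t k r] k t r by (simp add: add.commute)
    finally show "t powr r + real (d - 1) \<le> (k + t) powr r" .
  qed (use r in auto)
  also have "\<dots> = k + t" using k t r by (simp add: powr_powr)
  finally show ?thesis using r(2) by (simp add: k_def t_def r(1) one_ereal_def)
qed

section \<open>Lower tail of the squared length of a Gaussian vector\<close>

lemma nn_integral_gauss_prod:
  assumes "f \<in> borel_measurable borel"
  shows "(\<integral>\<^sup>+g. (\<Prod>i<d. f (g i)) \<partial>gauss d) = (\<integral>\<^sup>+x. f x \<partial>std_gauss) ^ d"
proof -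
  interpret product_sigma_finite "\<lambda>_::nat. std_gauss"
    by (intro product_sigma_finite.intro sigma_finite_std_gauss)
  have "f \<in> borel_measurable std_gauss"
    using assms unfolding measurable_cong_sets[OF sets_std_gauss refl] .
  then show ?thesis
    unfolding gauss_def by (subst product_nn_integral_prod) auto
qed

text \<open>The integrand times the standard density is \<open>1 / sqrt 2\<close> times the Gaussian
  density of standard deviation \<open>1 / sqrt 2\<close>.\<close>

lemma nn_integral_std_gauss_exp: "(\<integral>\<^sup>+x. ennreal (exp (- (x\<^sup>2 / 2))) \<partial>std_gauss) = ennreal (1 / sqrt 2)"
proof -
  have "std_normal_density x * exp (- (x\<^sup>2 / 2)) = 1 / sqrt 2 * normal_density 0 (1 / sqrt 2) x" for x
    by (simp add: normal_density_def exp_add[symmetric] power_divide real_sqrt_mult real_sqrt_divide field_simps)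
  then have "(\<integral>\<^sup>+x. ennreal (exp (- (x\<^sup>2 / 2))) \<partial>std_gauss)
      = (\<integral>\<^sup>+x. ennreal (1 / sqrt 2) * ennreal (normal_density 0 (1 / sqrt 2) x) \<partial>lborel)"
    by (simp add: nn_integral_std_gauss ennreal_mult'[symmetric])
  also have "\<dots> = ennreal (1 / sqrt 2)"
    by (subst nn_integral_cmult) (auto simp: nn_integral_eq_integral)
  finally show ?thesis .
qed

text \<open>A Chernoff bound: on the event, \<open>exp (real d / 8 - dot d g g / 2)\<close> is at
  least \<open>1\<close>, and by independence its expectation is the \<open>d\<close>-th power of
  \<open>exp (1 / 8) / sqrt 2\<close>.\<close>

lemma gauss_short_vector:
  assumes d: "1 \<le> d"
  shows "emeasure (gauss d) {g \<in> space (gauss d). dot d g g \<le> real d / 4} \<le> ennreal (5 / 6)"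
proof -
  let ?E = "{g \<in> space (gauss d). dot d g g \<le> real d / 4}"
  have E: "?E \<in> sets (gauss d)" by measurable
  have f: "(\<lambda>x::real. ennreal (exp (- (x\<^sup>2 / 2)))) \<in> borel_measurable borel" by measurable
  have "emeasure (gauss d) ?E = (\<integral>\<^sup>+g. indicator ?E g \<partial>gauss d)" using E by simp
  also have "\<dots> \<le> (\<integral>\<^sup>+g. ennreal (exp (real d / 8)) * (\<Prod>i<d. ennreal (exp (- ((g i)\<^sup>2 / 2)))) \<partial>gauss d)"
  proof (intro nn_integral_mono)
    fix g
    have "ennreal (exp (real d / 8)) * (\<Prod>i<d. ennreal (exp (- ((g i)\<^sup>2 / 2))))
        = ennreal (exp (real d / 8 - dot d g g / 2))"
      by (simp add: prod_ennreal ennreal_mult'[symmetric] exp_sum[symmetric] exp_add[symmetric]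
          dot_def sum_negf sum_divide_distrib power2_eq_square)
    then show "indicator ?E g \<le> ennreal (exp (real d / 8)) * (\<Prod>i<d. ennreal (exp (- ((g i)\<^sup>2 / 2))))"
      by (auto simp: indicator_def)
  qed
  also have "\<dots> = ennreal (exp (real d / 8)) * ennreal (1 / sqrt 2) ^ d"
    using measurable_compose[OF measurable_gauss_component f]
    by (simp add: nn_integral_cmult nn_integral_gauss_prod[OF f] nn_integral_std_gauss_exp)
  also have "\<dots> = ennreal ((exp (1 / 8) / sqrt 2) ^ d)"
    by (simp add: ennreal_power ennreal_mult'[symmetric] power_divide exp_of_nat_mult[symmetric])
  also have "\<dots> \<le> ennreal (5 / 6)"
  proof (rule ennreal_leI)
    \<comment> \<open>The base is at most \<open>1.140625 / 1.4\<close>, which is below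
      \<open>5 / 6\<close>; as \<open>d \<ge> 1\<close>, its power is no larger.\<close>
    have "exp (1 / 8 :: real) \<le> 1 + 1 / 8 + (1 / 8)\<^sup>2" by (rule exp_bound) auto
    moreover have "sqrt 2 \<ge> (14 / 10 :: real)" by (rule real_le_rsqrt) (simp add: power2_eq_square)
    ultimately have *: "exp (1 / 8) / sqrt 2 \<le> (5 / 6 :: real)"
      by (simp add: divide_le_eq power2_eq_square)
    have "(exp (1 / 8) / sqrt 2) ^ d \<le> (exp (1 / 8) / sqrt 2 :: real) ^ 1"
    proof (rule power_decreasing)
      show "exp (1 / 8) / sqrt 2 \<le> (1 :: real)" using * by linarith
    qed (use d in auto)
    with * show "(exp (1 / 8) / sqrt 2) ^ d \<le> (5 / 6 :: real)"
      unfolding power_one_right by linarith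
  qed
  finally show ?thesis .
qed

subsection \<open>Runs of an algorithm on rank-one perturbations\<close>

lemma answers_in_space: "answers T A r i \<in> space (answer_space i)"
proof (induction i)
  case 0
  then show ?case by (simp add: space_PiM)
next
  case (Suc i)
  then show ?case
    by (auto simp: space_PiM PiE_iff extensional_def less_Suc_eq split: prod.split)
qed

lemma query_carrier:
  assumes "vmv_algorithm_for d q T" "r \<in> space (coins T)" "i < q" "a \<in> space (answer_space i)"
    and "query T i r a = (v, w)"
  shows "v \<in> carrier_vec d" "w \<in> carrier_vec d"
proof -
  have "query T i r a \<in> carrier_vec d \<times> carrier_vec d"
    using assms(1-4) unfolding vmv_algorithm_for_def by blast
  then show "v \<in> carrier_vec d" "w \<in> carrier_vec d" using assms(5) by auto
qed

text \<open>Downward induction on the number \<open>i\<close> of answers already known. Once they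
  are fixed, the next query is a fixed pair \<open>(v, w)\<close>, and measuring \<open>g\<close>
  along \<open>v\<close> and \<open>w\<close> determines its answer. Each remaining query thus costs
  two measurements.\<close>

lemma decided_answers:
  assumes T: "vmv_algorithm_for d q T" "r \<in> space (coins T)" and "i \<le> q"
  shows "decided d (2 * (q - i)) {g. answers T (spike d \<mu> g) r i = a} (\<lambda>g. F (answers T (spike d \<mu> g) r q))"
  using assms(3)
proof (induction i arbitrary: a rule: inc_induct)
  case base
  then show ?case by simp
next
  case (step i)
  show ?case
  proof (cases "a \<in> space (answer_space i)")
    case False
    then have "{g. answers T (spike d \<mu> g) r i = a} = {}" by (auto simp: answers_in_space)
    then show ?thesis by (simp add: decided_empty)
  next
    case True
    obtain v w where vw: "query T i r a = (v, w)" by force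
    then have c: "v \<in> carrier_vec d" "w \<in> carrier_vec d"
      using query_carrier[OF T _ True vw] step by simp_all
    let ?S = "{g. answers T (spike d \<mu> g) r i = a}"
    have next_answer: "answers T (spike d \<mu> g) r (Suc i)
        = a(i := dot d (($) v) (($) w) - \<mu> * (dot d (($) v) g * dot d (($) w) g))"
      if "answers T (spike d \<mu> g) r i = a" for g
      using that by (simp add: vw spike_bilinear[OF c])
    \<comment> \<open>On this joint fibre all runs extend \<open>a\<close> by the same answer, so
      the fibre lies in one treated by the induction hypothesis.\<close>
    have "decided d (2 * (q - Suc i)) {g \<in> {g \<in> ?S. dot d (($) v) g = s}. dot d (($) w) g = t}
        (\<lambda>g. F (answers T (spike d \<mu> g) r q))" for s t
      by (rule decided_subset[OF step.IH[of "a(i := dot d (($) v) (($) w) - \<mu> * (s * t))"]], rule subsetI)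
        (simp add: next_answer fun_upd_def del: answers.simps)
    then have "decided d (Suc (Suc (2 * (q - Suc i)))) ?S (\<lambda>g. F (answers T (spike d \<mu> g) r q))"
      by (simp only: decided.simps) blast
    also have "Suc (Suc (2 * (q - Suc i))) = 2 * (q - i)" using step by simp
    finally show ?thesis .
  qed
qed

lemma measurable_answers:
  assumes T: "vmv_algorithm_for d q T" and "i \<le> q"
  shows "(\<lambda>(r, g). answers T (spike d \<mu> g) r i) \<in> measurable (coins T \<Otimes>\<^sub>M gauss d) (answer_space i)"
  using assms(2)
proof (induction i)
  case 0
  then show ?case by (simp add: space_PiM measurable_const)
next
  case (Suc i)
  let ?P = "coins T \<Otimes>\<^sub>M gauss d"
  let ?a = "\<lambda>x. answers T (spike d \<mu> (snd x)) (fst x) i"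
  define v where "v = (\<lambda>x j. fst (query T i (fst x) (?a x)) $ j)"
  define w where "w = (\<lambda>x j. snd (query T i (fst x) (?a x)) $ j)"
  have a: "?a \<in> measurable ?P (answer_space i)" using Suc by (simp add: case_prod_beta)
  then have ra: "(\<lambda>x. (fst x, ?a x)) \<in> measurable ?P (coins T \<Otimes>\<^sub>M answer_space i)"
    by (intro measurable_Pair measurable_fst)
  have q: "(\<lambda>(r, a). fst (query T i r a) $ j) \<in> borel_measurable (coins T \<Otimes>\<^sub>M answer_space i)"
    "(\<lambda>(r, a). snd (query T i r a) $ j) \<in> borel_measurable (coins T \<Otimes>\<^sub>M answer_space i)"
    if "j < d" for j
    using T Suc.prems that by (auto simp: vmv_algorithm_for_def)
  have v: "(\<lambda>x. v x j) \<in> borel_measurable ?P" and w: "(\<lambda>x. w x j) \<in> borel_measurable ?P"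
    if "j < d" for j
    using measurable_compose[OF ra q(1)[OF that]] measurable_compose[OF ra q(2)[OF that]]
    by (simp_all add: v_def w_def)
  have g: "(\<lambda>x. snd x j) \<in> borel_measurable ?P" if "j < d" for j
    by (rule measurable_compose[OF measurable_snd]) (use that in simp)
  \<comment> \<open>The next answer is expressed through coordinates, because measurability of
    queries is assumed coordinatewise.\<close>
  define z where "z = (\<lambda>x. dot d (v x) (w x) - \<mu> * (dot d (v x) (snd x) * dot d (w x) (snd x)))"
  have z: "z \<in> borel_measurable ?P"
    unfolding z_def using v w g by (intro borel_measurable_diff borel_measurable_times measurable_dot) auto
  have step: "answers T (spike d \<mu> g) r (Suc i) = (answers T (spike d \<mu> g) r i)(i := z (r, g))"
    if "r \<in> space (coins T)" for r g
  proof -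
    obtain v' w' where vw: "query T i r (answers T (spike d \<mu> g) r i) = (v', w')" by force
    then have "v' \<in> carrier_vec d" "w' \<in> carrier_vec d"
      using query_carrier[OF T that _ answers_in_space vw] Suc.prems by simp_all
    then show ?thesis by (simp add: vw z_def v_def w_def spike_bilinear)
  qed
  have "(\<lambda>x. (?a x)(i := z x)) \<in> measurable ?P (answer_space (Suc i))"
    unfolding lessThan_Suc
    by (rule measurable_fun_upd[OF _ a z]) auto
  then show ?case
    by (rule measurable_cong[THEN iffD1, rotated]) (auto simp: space_pair_measure step simp del: answers.simps)
qed

lemma finitary_spike: "finitary d (\<lambda>g. F (spike d \<mu> g))"
proof -
  have "spike d \<mu> g = spike d \<mu> h" if "\<forall>i<d. g i = h i" for g h
    by (rule eq_matI) (use that in \<open>auto simp: spike_def\<close>)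
  then show ?thesis unfolding finitary_def by metis
qed

lemma measurable_verdict:
  assumes T: "vmv_algorithm_for d q T"
  shows "Measurable.pred (coins T \<Otimes>\<^sub>M gauss d) (\<lambda>x. verdict q T (spike d \<mu> (snd x)) (fst x))"
proof -
  have acc: "Measurable.pred (coins T \<Otimes>\<^sub>M answer_space q) (\<lambda>(r, a). accept T r a)"
    using T by (simp add: vmv_algorithm_for_def)
  have "(\<lambda>x. (fst x, answers T (spike d \<mu> (snd x)) (fst x) q))
      \<in> measurable (coins T \<Otimes>\<^sub>M gauss d) (coins T \<Otimes>\<^sub>M answer_space q)"
    using measurable_answers[OF T order.refl] by (intro measurable_Pair measurable_fst) (simp add: case_prod_beta)
  from measurable_compose[OF this acc] show ?thesis by (simp add: verdict_def)
qed

text \<open>For fixed coins, one-sidedness allows rejection only where \<open>dot d g g\<close>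
  exceeds \<open>1 / \<mu>\<close>. So the indicator of rejection, scaled by
  \<open>1 / \<mu>\<close>, is at most \<open>dot d g g\<close>, and the bound for functions decided
  by \<open>2 * q\<close> measurements applies with \<open>c = 0\<close>.\<close>

lemma nn_integral_rejected_le:
  assumes T: "vmv_algorithm_for d q T" "one_sided d q T" and r: "r \<in> space (coins T)" and \<mu>: "\<mu> > 0"
  shows "(\<integral>\<^sup>+g. indicator {g. \<not> verdict q T (spike d \<mu> g) r} g \<partial>gauss d) \<le> ennreal (\<mu> * real (2 * q))"
proof -
  define h :: "(nat \<Rightarrow> real) \<Rightarrow> ennreal" where "h = indicator {g. \<not> verdict q T (spike d \<mu> g) r}"
  have [measurable]: "Measurable.pred (gauss d) (\<lambda>g. verdict q T (spike d \<mu> g) r)"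
    using measurable_compose[OF measurable_Pair1'[OF r] measurable_verdict[OF T(1)]] by simp
  have h: "h \<in> borel_measurable (gauss d)" unfolding h_def by measurable
  have "(\<integral>\<^sup>+g. ennreal (1 / \<mu>) * h g \<partial>gauss d) \<le> ennreal (0 + real (2 * q))"
  proof (rule nn_integral_decided_le)
    show "(\<lambda>g. ennreal (1 / \<mu>) * h g) \<in> borel_measurable (gauss d)" using h by simp
    show "finitary d (\<lambda>g. ennreal (1 / \<mu>) * h g)"
      unfolding h_def indicator_def mem_Collect_eq by (rule finitary_spike)
    \<comment> \<open>Before any query the answer tuple is \<open>\<lambda>_. undefined\<close> for
      every \<open>g\<close>, so the initial fibre is the whole space.\<close>
    have "decided d (2 * (q - 0)) UNIV (\<lambda>g. (\<lambda>a. ennreal (1 / \<mu>) * of_bool (\<not> accept T r a)) (answers T (spike d \<mu> g) r q))"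
      by (rule decided_subset[OF decided_answers[OF T(1) r, where a = "\<lambda>_. undefined"]]) auto
    then show "decided d (2 * q) UNIV (\<lambda>g. ennreal (1 / \<mu>) * h g)"
      by (simp add: h_def indicator_def verdict_def)
    fix g
    show "ennreal (1 / \<mu>) * h g \<le> ennreal (0 + dot d g g)"
    proof (cases "verdict q T (spike d \<mu> g) r")
      case False
      then have "spike d \<mu> g \<notin> psd_mats d" using T(2) r by (auto simp: one_sided_def)
      then have "\<mu> * dot d g g > 1" using spike_in_psd_mats[of \<mu> d g] \<mu> by force
      then have "1 / \<mu> \<le> dot d g g" using \<mu> by (simp add: divide_le_eq mult.commute)
      then show ?thesis using False by (simp add: h_def ennreal_leI)
    qed (simp add: h_def)
  qed simp
  then have "ennreal \<mu> * (ennreal (1 / \<mu>) * (\<integral>\<^sup>+g. h g \<partial>gauss d)) \<le> ennreal \<mu> * ennreal (real (2 * q))"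
    using h by (intro mult_left_mono) (simp_all add: nn_integral_cmult)
  moreover have "ennreal \<mu> * (ennreal (1 / \<mu>) * z) = z" for z
    using \<mu> by (simp add: mult.assoc[symmetric] ennreal_mult'[symmetric])
  ultimately have "(\<integral>\<^sup>+g. h g \<partial>gauss d) \<le> ennreal \<mu> * ennreal (real (2 * q))" by simp
  also have "\<dots> = ennreal (\<mu> * real (2 * q))" using \<mu> by (simp add: ennreal_mult')
  finally show ?thesis by (simp add: h_def)
qed

section \<open>From rejection probabilities to the number of queries\<close>

text \<open>The joint probability of rejection over coins and \<open>g\<close> is computed in both
  orders. Long vectors have probability at least \<open>1 / 6\<close> and are each rejected with
  probability at least \<open>2 / 3\<close>, which gives \<open>1 / 9\<close>. For fixed coins the
  probability is at most \<open>2 * \<mu> * q\<close>.\<close>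

lemma queries_lower_bound:
  assumes T: "vmv_algorithm_for d q T" "one_sided d q T" and \<mu>: "\<mu> > 0" and d: "1 \<le> d"
    and rejects: "\<And>g. real d / 4 < dot d g g \<Longrightarrow>
      measure (coins T) {r \<in> space (coins T). \<not> verdict q T (spike d \<mu> g) r} \<ge> 2 / 3"
  shows "1 / 18 \<le> \<mu> * real q"
proof -
  interpret C: prob_space "coins T" using T(1) by (simp add: vmv_algorithm_for_def)
  interpret G: prob_space "gauss d" by (rule prob_space_gauss)
  interpret P: pair_sigma_finite "coins T" "gauss d" ..
  let ?short = "{g \<in> space (gauss d). dot d g g \<le> real d / 4}"
  let ?long = "{g \<in> space (gauss d). real d / 4 < dot d g g}"
  define h :: "'a \<Rightarrow> (nat \<Rightarrow> real) \<Rightarrow> ennreal"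
    where "h = (\<lambda>r. indicator {g. \<not> verdict q T (spike d \<mu> g) r})"
  note [measurable] = measurable_verdict[OF T(1), of \<mu>]
  have m: "(\<lambda>(r, g). h r g) \<in> borel_measurable (coins T \<Otimes>\<^sub>M gauss d)"
  proof -
    have "(\<lambda>x. indicator {x. \<not> verdict q T (spike d \<mu> (snd x)) (fst x)} x :: ennreal)
        \<in> borel_measurable (coins T \<Otimes>\<^sub>M gauss d)" by measurable
    then show ?thesis by (simp add: h_def case_prod_beta indicator_def)
  qed
  have sets: "?short \<in> sets (gauss d)" "?long \<in> sets (gauss d)" by measurable
  have "space (gauss d) - ?short = ?long" by auto
  then have "G.prob ?long = 1 - G.prob ?short" using G.prob_compl[OF sets(1)] by simp
  moreover have "G.prob ?short \<le> 5 / 6"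
    using gauss_short_vector[OF d] by (simp add: G.emeasure_eq_measure)
  ultimately have long: "G.prob ?long \<ge> 1 / 6" by linarith
  have "ennreal (2 / 3 * (1 / 6)) \<le> ennreal (2 / 3 * G.prob ?long)"
    using long by (intro ennreal_leI) simp
  also have "\<dots> = (\<integral>\<^sup>+g. ennreal (2 / 3) * indicator ?long g \<partial>gauss d)"
    using sets ennreal_mult[of "2 / 3" "G.prob ?long"]
    by (simp only: nn_integral_cmult_indicator G.emeasure_eq_measure) simp
  also have "\<dots> \<le> (\<integral>\<^sup>+g. \<integral>\<^sup>+r. h r g \<partial>coins T \<partial>gauss d)"
  proof (intro nn_integral_mono)
    fix g assume g: "g \<in> space (gauss d)"
    show "ennreal (2 / 3) * indicator ?long g \<le> (\<integral>\<^sup>+r. h r g \<partial>coins T)"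
    proof (cases "g \<in> ?long")
      case True
      let ?R = "{r \<in> space (coins T). \<not> verdict q T (spike d \<mu> g) r}"
      have [measurable]: "Measurable.pred (coins T) (\<lambda>r. verdict q T (spike d \<mu> g) r)"
        using measurable_compose[OF measurable_Pair2'[OF g] measurable_verdict[OF T(1)]] by simp
      have "?R \<in> sets (coins T)" by measurable
      then have "(\<integral>\<^sup>+r. indicator ?R r \<partial>coins T) = ennreal (C.prob ?R)"
        by (simp add: C.emeasure_eq_measure)
      moreover have "(\<integral>\<^sup>+r. h r g \<partial>coins T) = (\<integral>\<^sup>+r. indicator ?R r \<partial>coins T)"
        by (intro nn_integral_cong) (simp add: h_def indicator_def)
      moreover have "2 / 3 \<le> C.prob ?R" using True by (intro rejects) simp
      ultimately show ?thesis using True by (simp add: ennreal_leI)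
    qed simp
  qed
  also have "\<dots> = (\<integral>\<^sup>+r. \<integral>\<^sup>+g. h r g \<partial>gauss d \<partial>coins T)"
    by (rule P.Fubini'[OF m])
  also have "\<dots> \<le> (\<integral>\<^sup>+r. ennreal (\<mu> * real (2 * q)) \<partial>coins T)"
    unfolding h_def by (intro nn_integral_mono nn_integral_rejected_le T \<mu>)
  also have "\<dots> = ennreal (\<mu> * real (2 * q))" by (simp add: C.emeasure_space_1)
  finally have "2 / 3 * (1 / 6) \<le> \<mu> * real (2 * q)"
    using \<mu> by (subst (asm) ennreal_le_iff) auto
  then show ?thesis by simp
qed

text \<open>The scale \<open>\<mu>\<close> is chosen so that, for long \<open>g\<close>, the
  negative eigenvalue \<open>- m\<close> satisfies \<open>\<epsilon> * K < \<kappa> * m\<close>.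
  Together with \<open>\<epsilon> \<le> 1 - \<kappa>\<close> this makes \<open>m\<close> dominate
  \<open>\<epsilon> * (K + m)\<close>, which bounds \<open>\<epsilon>\<close> times the Schatten
  norm.\<close>

lemma spike_far_from_psd:
  fixes d :: nat and \<epsilon> \<kappa> :: real
  assumes p: "1 \<le> p" and d: "1 \<le> d" and \<epsilon>: "0 < \<epsilon>" "\<epsilon> \<le> 1 - \<kappa>" and \<kappa>: "0 < \<kappa>"
    and K: "K = real d powr real_of_ereal (1 / p)" "\<kappa> \<le> \<epsilon> * K"
    and g: "real d / 4 < dot d g g" and \<mu>: "\<mu> = 8 * (\<epsilon> * K) / (\<kappa> * real d)"
  shows "spike d \<mu> g \<in> sym_mats d - psd_mats d"
    and "lambda_min (spike d \<mu> g) \<le> - \<epsilon> * schatten_norm p (spike d \<mu> g)"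
proof -
  define m where "m = \<mu> * dot d g g - 1"
  have "\<epsilon> * K > 0" using K(2) \<kappa> by linarith
  then have "\<mu> > 0" using \<kappa> d \<mu> by simp
  then have "\<mu> * (real d / 4) < \<mu> * dot d g g" using g by simp
  \<comment> \<open>The product \<open>\<mu> * dot d g g\<close> exceeds \<open>2 * x\<close>, and
    \<open>x \<ge> 1\<close> absorbs the subtracted \<open>1\<close>, leaving
    \<open>m > x\<close>.\<close>
  moreover define x where "x = \<epsilon> * K / \<kappa>"
  have "\<mu> * (real d / 4) = 2 * x" using d \<kappa> \<mu> by (simp add: x_def field_simps)
  moreover have "x \<ge> 1" using K(2) \<kappa> by (simp add: x_def)
  ultimately have m: "m > x" "m > 0" by (simp_all add: m_def)
  then have "\<mu> * dot d g g > 1" by (simp add: m_def)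
  then show "spike d \<mu> g \<in> sym_mats d - psd_mats d" by (simp add: spike_notin_psd_mats)
  have "schatten_norm p (spike d \<mu> g) \<le> K + m"
    unfolding K(1) m_def using p d m(2) by (intro schatten_norm_spike_le) (simp_all add: m_def)
  then have "\<epsilon> * schatten_norm p (spike d \<mu> g) \<le> \<epsilon> * (K + m)"
    using \<epsilon> by (intro mult_left_mono) auto
  also have "\<dots> \<le> \<kappa> * m + (1 - \<kappa>) * m"
  proof -
    have "\<epsilon> * K \<le> \<kappa> * m" using m(1) \<kappa> by (simp add: x_def divide_less_eq mult.commute)
    moreover have "\<epsilon> * m \<le> (1 - \<kappa>) * m" using \<epsilon> m(2) by (intro mult_right_mono) auto
    ultimately show ?thesis by (simp add: distrib_left)
  qed
  also have "\<dots> = m" by (simp add: algebra_simps)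
  finally have "\<epsilon> * schatten_norm p (spike d \<mu> g) \<le> m" .
  moreover have "lambda_min (spike d \<mu> g) \<le> - m"
    using lambda_min_spike_le[OF \<open>\<mu> * dot d g g > 1\<close>] by (simp add: m_def)
  ultimately show "lambda_min (spike d \<mu> g) \<le> - \<epsilon> * schatten_norm p (spike d \<mu> g)" by simp
qed

text \<open>The constant \<open>c\<close> depends on \<open>\<kappa>\<close> only and is uniform in
  all other parameters. Reading all entries takes \<open>d * d\<close> queries and decides
  semidefiniteness, so no such bound can hold for fixed \<open>d\<close> as
  \<open>\<epsilon>\<close> tends to \<open>0\<close>; the condition \<open>\<kappa> \<le>
  \<epsilon> * real d powr real_of_ereal (1 / p)\<close> excludes this regime. The condition
  \<open>\<epsilon> \<le> 1 - \<kappa>\<close> keeps \<open>\<epsilon>\<close> away from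
  \<open>1\<close>.\<close>

theorem theorem15:
  shows "\<forall>\<kappa>::real. \<kappa> > 0 \<longrightarrow> (\<exists>c::real. c > 0 \<and>
    (\<forall>(p::ereal) (\<epsilon>::real) (d::nat) (q::nat) (T::'r vmv_algorithm).
       1 \<le> p \<and> 0 < \<epsilon> \<and> \<epsilon> < 1 \<and> 1 \<le> d \<and>
       \<kappa> \<le> \<epsilon> * real d powr real_of_ereal (1 / p) \<and> \<epsilon> \<le> 1 - \<kappa> \<and>
       psd_tester d \<epsilon> p q T \<and> one_sided d q T \<longrightarrow>
       real q \<ge> c * (1 / \<epsilon> * real d powr (1 - real_of_ereal (1 / p)))))"
proof (intro allI impI)
  fix \<kappa> :: real assume \<kappa>: "\<kappa> > 0"
  have bound: "real q \<ge> \<kappa> / 144 * (1 / \<epsilon> * real d powr (1 - real_of_ereal (1 / p)))"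
    if A: "1 \<le> p \<and> 0 < \<epsilon> \<and> \<epsilon> < 1 \<and> 1 \<le> d \<and>
       \<kappa> \<le> \<epsilon> * real d powr real_of_ereal (1 / p) \<and> \<epsilon> \<le> 1 - \<kappa> \<and>
       psd_tester d \<epsilon> p q T \<and> one_sided d q T"
    for p \<epsilon> d q and T :: "'r vmv_algorithm"
  proof -
    define K where "K = real d powr real_of_ereal (1 / p)"
    define \<mu> where "\<mu> = 8 * (\<epsilon> * K) / (\<kappa> * real d)"
    have a: "\<kappa> > 0" "1 \<le> p" "0 < \<epsilon>" "1 \<le> d" "\<kappa> \<le> \<epsilon> * K" "\<epsilon> \<le> 1 - \<kappa>"
      "psd_tester d \<epsilon> p q T" "one_sided d q T"
      using \<kappa> A by (auto simp: K_def)
    have T: "vmv_algorithm_for d q T" using a(7) by (simp add: psd_tester_def)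
    have K: "K > 0" using a(4) by (simp add: K_def)
    have \<mu>: "\<mu> > 0" using K a by (simp add: \<mu>_def)
    have "1 / 18 \<le> \<mu> * real q"
    proof (rule queries_lower_bound[OF T a(8) \<mu> a(4)])
      fix g assume "real d / 4 < dot d g g"
      from spike_far_from_psd[OF a(2,4,3,6,1) K_def a(5) this \<mu>_def] a(7)
      show "2 / 3 \<le> measure (coins T) {r \<in> space (coins T). \<not> verdict q T (spike d \<mu> g) r}"
        by (simp add: psd_tester_def)
    qed
    \<comment> \<open>The number \<open>144\<close> is \<open>18 * 8\<close>, with the
      \<open>8\<close> coming from \<open>\<mu>\<close>; the quotient \<open>real d / K\<close> is
      the power of \<open>d\<close> in the claim.\<close>
    then have "\<kappa> / 144 * (1 / \<epsilon> * (real d / K)) \<le> real q"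
      using a K by (simp add: \<mu>_def field_simps)
    then show ?thesis
      using a(4) by (simp add: K_def powr_diff)
  qed
  show "\<exists>c>0. \<forall>(p::ereal) (\<epsilon>::real) (d::nat) (q::nat) (T::'r vmv_algorithm).
       1 \<le> p \<and> 0 < \<epsilon> \<and> \<epsilon> < 1 \<and> 1 \<le> d \<and>
       \<kappa> \<le> \<epsilon> * real d powr real_of_ereal (1 / p) \<and> \<epsilon> \<le> 1 - \<kappa> \<and>
       psd_tester d \<epsilon> p q T \<and> one_sided d q T \<longrightarrow>
       real q \<ge> c * (1 / \<epsilon> * real d powr (1 - real_of_ereal (1 / p)))"
  proof (intro exI[of _ "\<kappa> / 144"] conjI)
    show "\<kappa> / 144 > 0" using \<kappa> by simp
  qed (use bound in blast)
qed

end
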